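(* For every $x\in\mathbb{C}\setminus\{0\}$ for which all terms below are defined (that is, $\Theta(-x^3;q^3)\ne0$ and $\Theta(-x^{-2};q)\neq 0$), $$\begin{aligned} f_{1,2,3}(x^{-1}q^2,q^3;q) ={}& x^{-1}m(x^{-3}q^2,-x^{3};q^{3})(q)_{\infty} + x^{-2}m(x^{-3}q,-x^{3};q^{3})(q)_{\infty}\\ &- x^{-1}\Theta(x;q)\,m(qx^{-2},-1;q) - \frac{(q^2;q^2)_{\infty}^3\,\Theta_{1,2}\,\Theta(-x;q)\,\Theta(x^{-3};q^3)}{\overline{\Theta}_{0,2}\,\overline{\Theta}_{1,2}\,\Theta(-x^{3};q^3)\,\Theta(-x^{-2};q)}. \end{aligned}$$
   Context: Throughout, $q\in\mathbb{C}$ with $0<|q|<1$. $(x;q)_\infty=\prod_{i\ge0}(1-xq^i)$, $(q)_\infty=(q;q)_\infty$, $\Theta(x;q)=(x;q)_\infty(q/x;q)_\infty(q;q)_\infty=\sum_{n\in\mathbb{Z}}(-1)^nq^{\binom n2}x^n$ (and likewise with $q$ replaced by a power of $q$), $\Theta_{a,m}=\Theta(q^a;q^m)$ and $\overline{\Theta}_{a,m}=\Theta(-q^a;q^m)$. Appell function: $$m(x,z;q)=\frac{1}{\Theta(z;q)}\sum_{r=-\infty}^{\infty}\frac{(-1)^rq^{\binom{r}{2}}z^r}{1-q^{r-1}xz}.$$ Hecke-type double-sum: with $\mathrm{sg}(r)=1$ if $r\ge0$, $-1$ if $r<0$, and $\mathrm{sg}(r,s)=\frac{\mathrm{sg}(r)+\mathrm{sg}(s)}{2}$,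 for positive integers $a,b,c$ with $b^2-ac>0$, $$f_{a,b,c}(x,y;q) = \sum_{r,s \in \mathbb{Z}} \mathrm{sg}(r,s) (-1)^{r+s} x^r y^s q^{a\binom{r}{2}+brs+c\binom{s}{2}}.$$ *)

theory Defs
  imports "HOL-Analysis.Analysis"
begin

text \<open>
  The base is a complex number \<open>q\<close> with \<open>0 < norm q < 1\<close>. Under this assumption the product
  and the series below converge absolutely (for \<open>appell_m\<close>, where its denominators do not
  vanish), so \<open>prodinf\<close> and \<open>infsum\<close> yield their genuine values and not the default value of
  a divergent expression. Integer exponents are written with \<open>powi\<close>.
\<close>

text \<open>The binomial coefficient \<open>r\<close> over 2 at an arbitrary integer; the division is exact.\<close>

definition binom2 :: "int \<Rightarrow> int" where
  "binom2 r = r * (r - 1) div 2"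

definition qpoch_inf :: "complex \<Rightarrow> complex \<Rightarrow> complex" where
  "qpoch_inf x q = (\<Prod>i. 1 - x * q ^ i)"

definition Theta :: "complex \<Rightarrow> complex \<Rightarrow> complex" where
  "Theta x q = qpoch_inf x q * qpoch_inf (q / x) q * qpoch_inf q q"

definition Theta_idx :: "int \<Rightarrow> nat \<Rightarrow> complex \<Rightarrow> complex" where
  "Theta_idx a m q = Theta (q powi a) (q ^ m)"

definition Theta_bar_idx :: "int \<Rightarrow> nat \<Rightarrow> complex \<Rightarrow> complex" where
  "Theta_bar_idx a m q = Theta (- (q powi a)) (q ^ m)"

definition appell_m :: "complex \<Rightarrow> complex \<Rightarrow> complex \<Rightarrow> complex" where
  "appell_m x z q =
     1 / Theta z q *
     (\<Sum>\<^sub>\<infinity>r\<in>(UNIV :: int set).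
        (-1) powi r * q powi binom2 r * z powi r / (1 - q powi (r - 1) * x * z))"

text \<open>Not the library's \<open>sgn\<close>: the value at 0 is 1.\<close>

definition sg :: "int \<Rightarrow> int" where
  "sg r = (if r \<ge> 0 then 1 else -1)"

definition sg2 :: "int \<Rightarrow> int \<Rightarrow> complex" where
  "sg2 r s = (of_int (sg r) + of_int (sg s)) / 2"

text \<open>Intended for positive \<open>a\<close>, \<open>b\<close>, \<open>c\<close> with \<open>b\<^sup>2 - a * c > 0\<close>.\<close>

definition hecke_f ::
    "nat \<Rightarrow> nat \<Rightarrow> nat \<Rightarrow> complex \<Rightarrow> complex \<Rightarrow> complex \<Rightarrow> complex" where
  "hecke_f a b c x y q =
     (\<Sum>\<^sub>\<infinity>(r, s)\<in>(UNIV :: (int \<times> int) set).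
        sg2 r s * (-1) powi (r + s) * x powi r * y powi s *
        q powi (int a * binom2 r + int b * r * s + int c * binom2 s))"

end

theory Submission
  imports Defs "HOL-Complex_Analysis.Complex_Analysis"
begin

text \<open>
  Multiply the difference of the two sides by \<open>Theta (- (x ^ 3)) (q ^ 3)\<close> and call the result
  \<open>H x\<close> (\<open>remainder_form\<close>). The proof shows that \<open>H\<close> extends to a holomorphic function on the
  punctured plane with \<open>H (q * x) = - H x\<close>. Such a function takes, up to sign, only the values that
  it takes on the compact annulus \<open>norm q \<le> norm x \<le> 1\<close>; so it is bounded, and Liouville's theorem,
  applied to \<open>H \<circ> exp\<close>, makes it a constant \<open>c\<close> with \<open>c = - c\<close>
  (\<open>antiperiodic_holomorphic_zero\<close>). Hence \<open>H = 0\<close>.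

  Antiperiodicity (\<open>remainder_form_shift\<close>). Each of the five pieces \<open>f\<close> of the identity satisfies a
  relation \<open>f (q * x) = - (x ^ 3) * f x + \<dots>\<close>, and the inhomogeneous parts cancel in total. For the
  double sum the substitution \<open>(r, s) \<mapsto> (r - 3, s + 2)\<close> multiplies every monomial by \<open>- (x ^ 3)\<close>
  and changes the sign factor only on the rows \<open>r = 0, 1, 2\<close> and the columns \<open>s = -1, -2\<close>. On each of
  these five strips the sum is a single theta series, evaluated by the Jacobi triple product; the two
  rows that survive are Euler's pentagonal number series, whence the factors
  \<open>qpoch_inf q q\<close> (\<open>hecke123_shift\<close>). The Appell functions are instances of the series \<open>lambert\<close>,
  whose shift relations are \<open>lambert_mult_base\<close> and \<open>lambert_div_base\<close>; theta functions are
  quasi-periodic.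

  Holomorphy. The double sum is a Laurent series that converges on the whole punctured plane. In the
  two Appell functions with base \<open>q ^ 3\<close> the variable \<open>x\<close> cancels from the denominators, which become
  \<open>1 + q powi (3 * r - 1)\<close> and \<open>1 + q powi (3 * r - 2)\<close>; multiplied by
  \<open>Theta (- (x ^ 3)) (q ^ 3)\<close> they are Laurent series too. Poles can occur only where
  \<open>Theta (- (x powi (-2))) q = 0\<close>, that is \<open>x ^ 2 = - (q powi m)\<close>. There the third Appell function and
  the theta quotient both have simple poles. At such a point \<open>- x = q powi m / x\<close>, so quasi-periodicity
  turns \<open>Theta (- x) q\<close> and \<open>Theta (x powi (-3)) (q ^ 3)\<close> into multiples of \<open>Theta x q\<close> and
  \<open>Theta (- (x ^ 3)) (q ^ 3)\<close>, and the two residues cancel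
  (\<open>residue_cancellation\<close>, \<open>remainder_form_removable\<close>).

  The triple product itself comes from its finite form, a rewriting of Rothe's \<open>q\<close>-binomial theorem,
  by dominated convergence.
\<close>

section \<open>Integer exponents and triangular numbers\<close>

lemma binom2_double: "2 * binom2 n = n * (n - 1)"
  unfolding binom2_def by simp

lemma binom2_0 [simp]: "binom2 0 = 0" and binom2_1 [simp]: "binom2 1 = 0"
  by (simp_all add: binom2_def)

lemma binom2_plus1: "binom2 (n + 1) = binom2 n + n"
  using binom2_double[of n] binom2_double[of "n+1"] by (simp add: algebra_simps)

lemma binom2_uminus: "binom2 (- n) = binom2 n + n"
  using binom2_double[of n] binom2_double[of "-n"] by (simp add: algebra_simps)

lemma binom2_add: "binom2 (m + n) = binom2 m + binom2 n + m * n"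
  using binom2_double[of n] binom2_double[of m] binom2_double[of "m+n"] by (simp add: algebra_simps)

lemma norm_q_powi_ne_1:
  fixes q :: complex
  assumes "norm q < 1" "q \<noteq> 0" "n \<noteq> 0"
  shows "norm (q powi n) \<noteq> 1"
proof (cases "n > 0")
  case True
  hence "norm q powi n < 1" using assms by (simp add: power_int_def power_less_one_iff)
  thus ?thesis by (simp add: norm_power_int)
next
  case False
  hence "norm q powi (-n) < 1" using assms by (simp add: power_int_def power_less_one_iff)
  thus ?thesis by (auto simp: norm_power_int power_int_minus)
qed

lemma norm_power_lt_1: "norm (q::complex) < 1 \<Longrightarrow> n > 0 \<Longrightarrow> norm (q ^ n) < 1"
  by (simp add: norm_power power_less_one_iff)

lemma power_int_le_add_endpoints:
  fixes a t b :: real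
  assumes "0 < a" "a \<le> t" "t \<le> b"
  shows "t powi r \<le> a powi r + b powi r"
proof (cases "r \<ge> 0")
  case True
  hence "t powi r \<le> b powi r"
    using assms by (simp add: power_int_def power_mono)
  thus ?thesis using assms by (simp add: add_increasing)
next
  case False
  have "inverse t \<le> inverse a" using assms by (intro le_imp_inverse_le) auto
  hence "t powi r \<le> a powi r"
    using False assms unfolding power_int_def by (auto intro!: power_mono)
  thus ?thesis using assms by (simp add: add_increasing2)
qed

text \<open>On the ball of radius \<open>norm x / 2\<close> around \<open>x\<close> the modulus stays within these two bounds, so that a
  Laurent monomial is bounded there by its values at the two endpoints
  (\<open>power_int_le_add_endpoints\<close>). This supplies majorants that are uniform on the ball.\<close>

lemma ball_half_norm:
  fixes x y :: complex
  assumes "y \<in> cball x (norm x / 2)"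
  shows "norm x / 2 \<le> norm y" "norm y \<le> 2 * norm x"
proof -
  have d: "norm (x - y) \<le> norm x / 2" using assms by (simp add: dist_norm)
  show "norm x / 2 \<le> norm y" using norm_triangle_ineq2[of x y] d by linarith
  show "norm y \<le> 2 * norm x"
    using norm_triangle_ineq2[of y x] d norm_ge_zero[of x] unfolding norm_minus_commute[of y x] by linarith
qed

section \<open>Infinite products and theta functions\<close>

lemma qpoch_inf_convergent:
  fixes q x :: complex
  assumes "norm q < 1"
  shows "convergent_prod (\<lambda>i. 1 - x * q ^ i)"
proof -
  have "summable (\<lambda>i. norm (1 - x * q ^ i - 1))"
    using assms by (simp add: norm_mult norm_power summable_mult summable_geometric)
  thus ?thesis
    by (intro abs_convergent_prod_imp_convergent_prod summable_imp_abs_convergent_prod)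
qed

lemma qpoch_inf_LIMSEQ:
  assumes "norm q < 1"
  shows "(\<lambda>n. \<Prod>i<n. 1 - x * q ^ i) \<longlonglongrightarrow> qpoch_inf x q"
  using convergent_prod_LIMSEQ[OF qpoch_inf_convergent[OF assms, of x]]
  unfolding qpoch_inf_def LIMSEQ_lessThan_iff_atMost .

text \<open>A convergent infinite product vanishes only if one of its factors does. Conversely, if a factor is
  \<open>0\<close>, then the partial products are eventually \<open>0\<close>.\<close>

lemma qpoch_inf_eq_0_iff:
  assumes "norm q < 1"
  shows "qpoch_inf x q = 0 \<longleftrightarrow> (\<exists>i. x * q ^ i = 1)"
proof
  assume "qpoch_inf x q = 0"
  hence "\<exists>i. 1 - x * q ^ i = 0"
    using prodinf_nonzero[OF qpoch_inf_convergent[OF assms, of x]]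
    unfolding qpoch_inf_def by blast
  thus "\<exists>i. x * q ^ i = 1" by (metis eq_iff_diff_eq_0)
next
  assume "\<exists>i. x * q ^ i = 1"
  then obtain k where k: "x * q ^ k = 1" by blast
  have "eventually (\<lambda>n. (\<Prod>i<n. 1 - x * q ^ i) = 0) sequentially"
    using eventually_gt_at_top[of k] by eventually_elim (use k in auto)
  from tendsto_eventually[OF this] show "qpoch_inf x q = 0"
    using LIMSEQ_unique[OF qpoch_inf_LIMSEQ[OF assms]] by blast
qed

lemma qpoch_inf_self_nonzero:
  assumes "norm q < 1"
  shows "qpoch_inf q q \<noteq> 0"
proof
  assume "qpoch_inf q q = 0"
  then obtain i where "q ^ Suc i = 1"
    using qpoch_inf_eq_0_iff[OF assms, of q] by auto
  hence "norm q ^ Suc i = 1" by (metis norm_one norm_power)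
  moreover have "norm q ^ Suc i < 1"
    using assms power_less_one_iff[of "norm q" "Suc i"] by simp
  ultimately show False by simp
qed

lemma qpoch_inf_split_first:
  assumes "norm q < 1"
  shows "qpoch_inf x q = (1 - x) * qpoch_inf (x * q) q"
proof -
  have "(\<lambda>n. \<Prod>i<Suc n. 1 - x * q ^ i) \<longlonglongrightarrow> qpoch_inf x q"
    using LIMSEQ_Suc[OF qpoch_inf_LIMSEQ[OF assms]] .
  moreover have "(\<Prod>i<Suc n. 1 - x * q ^ i) = (1 - x) * (\<Prod>i<n. 1 - (x * q) * q ^ i)" for n
    unfolding prod.lessThan_Suc_shift by (simp add: mult.assoc)
  ultimately have "(\<lambda>n. (1 - x) * (\<Prod>i<n. 1 - (x * q) * q ^ i)) \<longlonglongrightarrow> qpoch_inf x q"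
    by simp
  moreover have "(\<lambda>n. (1 - x) * (\<Prod>i<n. 1 - (x * q) * q ^ i)) \<longlonglongrightarrow> (1 - x) * qpoch_inf (x * q) q"
    by (intro tendsto_intros qpoch_inf_LIMSEQ assms)
  ultimately show ?thesis by (rule LIMSEQ_unique)
qed

text \<open>Sort the factors by the residue of the index modulo \<open>k\<close>.\<close>

lemma qpoch_inf_multisection:
  assumes "norm q < 1" and "k > 0"
  shows "qpoch_inf x q = (\<Prod>j<k. qpoch_inf (x * q ^ j) (q ^ k))"
proof -
  have qk: "norm (q ^ k) < 1"
    using assms by (simp add: norm_power power_less_one_iff)
  have "(\<lambda>n. \<Prod>j<k. \<Prod>i<n. 1 - x * q ^ j * (q ^ k) ^ i)
           \<longlonglongrightarrow> (\<Prod>j<k. qpoch_inf (x * q ^ j) (q ^ k))"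
    by (intro tendsto_prod qpoch_inf_LIMSEQ qk)
  moreover have "(\<Prod>j<k. \<Prod>i<n. 1 - x * q ^ j * (q ^ k) ^ i) = (\<Prod>i<n*k. 1 - x * q ^ i)" for n
  proof -
    have "(\<Prod>j<k. \<Prod>i<n. 1 - x * q ^ j * (q ^ k) ^ i) =
          (\<Prod>i<n. \<Prod>j<k. 1 - x * q ^ j * (q ^ k) ^ i)"
      by (rule prod.swap)
    also have "\<dots> = (\<Prod>i<n. \<Prod>m=i*k..<i*k+k. 1 - x * q ^ m)"
    proof (rule prod.cong[OF refl])
      fix i
      have eq: "(q ^ k) ^ i = q ^ (i * k)"
        by (simp add: mult.commute flip: power_mult)
      show "(\<Prod>j<k. 1 - x * q ^ j * (q ^ k) ^ i) = (\<Prod>m=i*k..<i*k+k. 1 - x * q ^ m)"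
        by (rule prod.reindex_bij_witness[of _ "\<lambda>m. m - i*k" "\<lambda>j. j + i*k"])
           (auto simp: power_add eq)
    qed
    also have "\<dots> = (\<Prod>i<n*k. 1 - x * q ^ i)"
      by (rule prod.nat_group)
    finally show ?thesis .
  qed
  moreover have "(\<lambda>n. \<Prod>i<n*k. 1 - x * q ^ i) \<longlonglongrightarrow> qpoch_inf x q"
  proof (rule filterlim_compose[OF qpoch_inf_LIMSEQ[OF assms(1)]])
    show "filterlim (\<lambda>n. n * k) at_top sequentially"
      using assms(2) by (intro filterlim_subseq) (simp add: strict_mono_def)
  qed
  ultimately show ?thesis using LIMSEQ_unique by auto
qed

lemma qpoch_inf_holomorphic:
  assumes "norm q < 1"
  shows "(\<lambda>x. qpoch_inf x q) holomorphic_on UNIV"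
proof (rule holomorphic_uniform_sequence[where f = "\<lambda>n x. \<Prod>i<n. 1 - x * q ^ i"])
  fix z :: complex
  have "uniformly_convergent_on (cball z 1) (\<lambda>n x. \<Prod>i<n. 1 - x * q ^ i)"
  proof (rule uniformly_convergent_on_prod')
    show "uniformly_convergent_on (cball z 1) (\<lambda>N x. \<Sum>n<N. norm (1 - x * q ^ n - 1))"
    proof (rule Weierstrass_m_test'_ev)
      show "summable (\<lambda>n. (norm z + 1) * norm q ^ n)"
        using assms by (intro summable_mult summable_geometric) auto
      have "norm (norm (1 - x * q ^ n - 1)) \<le> (norm z + 1) * norm q ^ n" if "x \<in> cball z 1" for x n
      proof -
        have "norm x \<le> norm z + 1"
          using that norm_triangle_sub[of x z] by (simp add: dist_norm norm_minus_commute)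
        thus ?thesis by (simp add: norm_mult norm_power mult_right_mono)
      qed
      thus "\<forall>\<^sub>F n in sequentially. \<forall>x\<in>cball z 1. norm (norm (1 - x * q ^ n - 1)) \<le> (norm z + 1) * norm q ^ n"
        by auto
    qed
  qed (auto intro!: continuous_intros)
  then obtain l where l: "uniform_limit (cball z 1) (\<lambda>n x. \<Prod>i<n. 1 - x * q ^ i) l sequentially"
    unfolding uniformly_convergent_on_def by blast
  have "l x = qpoch_inf x q" if "x \<in> cball z 1" for x
    using tendsto_uniform_limitI[OF l that] qpoch_inf_LIMSEQ[OF assms] LIMSEQ_unique by blast
  hence "uniform_limit (cball z 1) (\<lambda>n x. \<Prod>i<n. 1 - x * q ^ i) (\<lambda>x. qpoch_inf x q) sequentially"
    using l by (metis (no_types, lifting) uniform_limit_cong')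
  thus "\<exists>d>0. cball z d \<subseteq> UNIV \<and> uniform_limit (cball z d) (\<lambda>n x. \<Prod>i<n. 1 - x * q ^ i) (\<lambda>x. qpoch_inf x q) sequentially"
    by (intro exI[of _ 1]) auto
qed (auto intro!: holomorphic_intros)

lemma qpoch_inf_analytic [analytic_intros]:
  assumes "norm q < 1" and "f analytic_on A"
  shows "(\<lambda>x. qpoch_inf (f x) q) analytic_on A"
proof -
  have "(\<lambda>x. qpoch_inf x q) analytic_on UNIV"
    using qpoch_inf_holomorphic[OF assms(1)] by (simp add: analytic_on_open)
  from analytic_on_compose_gen[OF assms(2) this] show ?thesis
    by (simp add: o_def)
qed

lemma Theta_analytic [analytic_intros]:
  assumes "norm q < 1" and "f analytic_on A" and "\<And>x. x \<in> A \<Longrightarrow> f x \<noteq> 0"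
  shows "(\<lambda>x. Theta (f x) q) analytic_on A"
  unfolding Theta_def using assms by (intro analytic_intros) auto

lemma Theta_mult_q:
  assumes "norm q < 1" "q \<noteq> 0" "x \<noteq> 0"
  shows "Theta (q * x) q = - Theta x q / x"
proof -
  have "qpoch_inf (1 / x) q = (1 - 1 / x) * qpoch_inf (q / x) q"
    using qpoch_inf_split_first[OF assms(1), of "1/x"] by simp
  moreover have "qpoch_inf x q = (1 - x) * qpoch_inf (q * x) q"
    using qpoch_inf_split_first[OF assms(1), of x] by (simp add: mult.commute)
  moreover define W where "W = qpoch_inf (q * x) q * qpoch_inf (q / x) q * qpoch_inf q q"
  ultimately have W: "Theta (q * x) q = (1 - 1 / x) * W" "Theta x q = (1 - x) * W"
    using assms by (simp_all add: Theta_def)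
  show ?thesis
    unfolding W using assms by (simp add: field_simps)
qed

lemma Theta_q_over [simp]: "q \<noteq> 0 \<Longrightarrow> Theta (q / x) q = Theta x q"
  unfolding Theta_def by (cases "x = 0") auto

lemma Theta_inverse:
  assumes "norm q < 1" "q \<noteq> 0" "x \<noteq> 0"
  shows "Theta (1 / x) q = - Theta x q / x"
  using Theta_mult_q[OF assms] Theta_q_over[OF assms(2), of "q * x"] assms by simp

text \<open>The quasi-periodicity, iterated. It says that the quantity \<open>g n\<close> of the proof is independent of \<open>n\<close>.\<close>

lemma Theta_mult_q_powi:
  assumes "norm q < 1" "q \<noteq> 0" "x \<noteq> 0"
  shows "Theta (q powi n * x) q = (-1) powi n * q powi (- binom2 n) * x powi (- n) * Theta x q"
proof -
  define g where "g n = (-1) powi n * q powi binom2 n * x powi n * Theta (q powi n * x) q" for n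
  have step: "g (n + 1) = g n" for n
  proof -
    have "Theta (q powi (n+1) * x) q = - Theta (q powi n * x) q / (q powi n * x)"
      using Theta_mult_q[OF assms(1,2), of "q powi n * x"] assms
      by (simp add: power_int_add mult_ac)
    thus ?thesis
      using assms unfolding g_def binom2_plus1 by (simp add: power_int_add)
  qed
  have "g n = g 0"
  proof (induction n rule: int_induct[of _ 0])
    case (step1 i) thus ?case using step[of i] by simp
  next
    case (step2 i) thus ?case using step[of "i-1"] by simp
  qed simp
  hence eq: "(-1) powi n * q powi binom2 n * x powi n * Theta (q powi n * x) q = Theta x q"
    by (simp add: g_def)
  have sq: "(-1) powi n * (-1) powi n = (1::complex)"
    by (simp flip: power_int_mult_distrib)
  have "Theta (q powi n * x) q = ((-1) powi n * (-1) powi n) * q powi (- binom2 n) * x powi (- n) *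
           (q powi binom2 n * x powi n * Theta (q powi n * x) q)"
    using assms unfolding sq by (simp add: power_int_minus field_simps)
  also have "\<dots> = (-1) powi n * q powi (- binom2 n) * x powi (- n) * Theta x q"
    unfolding eq[symmetric] by (simp only: mult_ac)
  finally show ?thesis .
qed

lemma Theta_eq_0_iff:
  assumes "norm q < 1" "q \<noteq> 0" "x \<noteq> 0"
  shows "Theta x q = 0 \<longleftrightarrow> (\<exists>n::int. x = q powi n)"
proof
  assume "Theta x q = 0"
  hence "qpoch_inf x q = 0 \<or> qpoch_inf (q / x) q = 0"
    using qpoch_inf_self_nonzero[OF assms(1)] by (simp add: Theta_def)
  then consider i where "x * q ^ i = 1" | i where "q / x * q ^ i = 1"
    using qpoch_inf_eq_0_iff[OF assms(1)] by blast
  thus "\<exists>n::int. x = q powi n"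
  proof cases
    case 1
    hence "x = q powi (- int i)" using assms by (simp add: power_int_minus field_simps)
    thus ?thesis by blast
  next
    case 2
    hence "x = q powi (int (Suc i))" using assms by (simp del: of_nat_Suc add: field_simps)
    thus ?thesis by blast
  qed
next
  assume "\<exists>n::int. x = q powi n"
  then obtain n :: int where n: "x = q powi n" by blast
  have "Theta 1 q = 0"
    using qpoch_inf_split_first[OF assms(1), of 1] by (simp add: Theta_def)
  thus "Theta x q = 0"
    using Theta_mult_q_powi[OF assms(1,2), of 1 n] n by simp
qed

text \<open>The theta function without its factor \<open>1 - x\<close>. It gives the leading coefficient of \<open>Theta\<close> at its
  simple zero \<open>1\<close> without a limit.\<close>

definition Theta_reduced :: "complex \<Rightarrow> complex \<Rightarrow> complex" where
  "Theta_reduced x q = qpoch_inf (q * x) q * qpoch_inf (q / x) q * qpoch_inf q q"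

lemma Theta_conv_reduced:
  assumes "norm q < 1"
  shows "Theta x q = (1 - x) * Theta_reduced x q"
  using qpoch_inf_split_first[OF assms, of x]
  by (simp add: Theta_def Theta_reduced_def mult.commute mult.left_commute)

lemma Theta_reduced_1: "Theta_reduced 1 q = qpoch_inf q q ^ 3"
  by (simp add: Theta_reduced_def power3_eq_cube)

lemma Theta_reduced_analytic [analytic_intros]:
  assumes "norm q < 1" and "f analytic_on A" and "\<And>x. x \<in> A \<Longrightarrow> f x \<noteq> 0"
  shows "(\<lambda>x. Theta_reduced (f x) q) analytic_on A"
  unfolding Theta_reduced_def using assms by (intro analytic_intros) auto

lemma Theta_minus_1_nonzero:
  assumes "norm q < 1" "q \<noteq> 0"
  shows "Theta (-1) q \<noteq> 0"
proof
  assume "Theta (-1) q = 0"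
  then obtain n :: int where n: "-1 = q powi n" using Theta_eq_0_iff[OF assms] by auto
  hence "norm (q powi n) = 1" by (metis norm_minus_cancel norm_one)
  hence "n = 0" using norm_q_powi_ne_1[OF assms] by blast
  thus False using n by simp
qed

text \<open>The constant in front of the theta quotient of the main identity is the leading coefficient
  \<open>Theta_reduced 1 q\<close> of \<open>Theta\<close> at its zero \<open>1\<close>, divided by \<open>Theta (-1) q\<close>. It is in this form that
  the residues are seen to cancel.\<close>

lemma theta_quotient_constant:
  assumes "norm q < 1" "q \<noteq> 0"
  shows "qpoch_inf (q ^ 2) (q ^ 2) ^ 3 * Theta_idx 1 2 q / (Theta_bar_idx 0 2 q * Theta_bar_idx 1 2 q)
     = qpoch_inf q q ^ 3 / Theta (-1) q"
proof -
  have s2: "qpoch_inf x q = qpoch_inf x (q\<^sup>2) * qpoch_inf (x * q) (q\<^sup>2)" for x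
    using qpoch_inf_multisection[OF assms(1), of 2 x] by (simp add: numeral_2_eq_2)
  have q2: "norm (q\<^sup>2) < 1" using assms by (simp add: norm_power power_less_one_iff)
  define A where "A = qpoch_inf q (q\<^sup>2)"
  define B where "B = qpoch_inf (q\<^sup>2) (q\<^sup>2)"
  define C where "C = qpoch_inf (-1) (q\<^sup>2)"
  define D where "D = qpoch_inf (-q) (q\<^sup>2)"
  define E where "E = qpoch_inf (-(q\<^sup>2)) (q\<^sup>2)"
  have qq: "qpoch_inf q q = A * B" and m1: "qpoch_inf (-1) q = C * D" and mq: "qpoch_inf (-q) q = D * E"
    using s2[of q] s2[of "-1"] s2[of "-q"] by (simp_all add: A_def B_def C_def D_def E_def power2_eq_square)
  have Th: "Theta_idx 1 2 q = A * A * B" "Theta_bar_idx 0 2 q = C * E * B"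
      "Theta_bar_idx 1 2 q = D * D * B" "Theta (-1) q = C * D * (D * E) * (A * B)"
    using assms by (simp_all add: Theta_idx_def Theta_bar_idx_def Theta_def power2_eq_square
        qq m1 mq A_def B_def C_def D_def E_def)
  have nz: "A \<noteq> 0" "B \<noteq> 0" "C \<noteq> 0" "D \<noteq> 0" "E \<noteq> 0"
    using qpoch_inf_self_nonzero[OF assms(1)] qq Theta_minus_1_nonzero[OF assms] Th(4) by auto
  show ?thesis
    unfolding Th qq B_def[symmetric] using nz by (simp add: divide_simps power3_eq_cube)
qed

text \<open>In base \<open>q ^ 3\<close> the three products in \<open>Theta\<close> run through the three residue classes of exponents
  modulo 3. Together with the triple product this is Euler's pentagonal number theorem.\<close>

lemma Theta_cubed_base:
  assumes "norm q < 1" "q \<noteq> 0"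
  shows "Theta q (q ^ 3) = qpoch_inf q q" "Theta (q ^ 2) (q ^ 3) = qpoch_inf q q"
proof -
  have "qpoch_inf q q = qpoch_inf q (q ^ 3) * qpoch_inf (q * q) (q ^ 3) * qpoch_inf (q * (q * q)) (q ^ 3)"
    using qpoch_inf_multisection[OF assms(1), of 3 q] by (simp add: numeral_3_eq_3)
  moreover have "q ^ 3 / q = q * q" "q ^ 3 / q ^ 2 = q" "q ^ 3 = q * (q * q)" "q ^ 2 = q * q"
    using assms by (simp_all add: eval_nat_numeral)
  ultimately show "Theta q (q ^ 3) = qpoch_inf q q" "Theta (q ^ 2) (q ^ 3) = qpoch_inf q q"
    by (simp_all only: Theta_def mult_ac)
qed

section \<open>Bilateral series and dominated convergence\<close>

lemma summable_on_int:
  fixes f :: "int \<Rightarrow> real"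
  assumes "(\<lambda>n::nat. f (int n)) summable_on UNIV" and "(\<lambda>n::nat. f (- int n)) summable_on UNIV"
  shows "f summable_on UNIV"
proof -
  have 1: "f summable_on range int"
    using assms(1) by (subst summable_on_reindex) (auto simp: o_def)
  have 2: "f summable_on range (\<lambda>n. - int n)"
    using assms(2) by (subst summable_on_reindex) (auto simp: o_def inj_on_def)
  have 3: "range int \<union> range (\<lambda>n. - int n) = UNIV"
  proof -
    have "n \<in> range int \<union> range (\<lambda>n. - int n)" for n
      by (cases n rule: int_cases2) auto
    thus ?thesis by blast
  qed
  show ?thesis using summable_on_union[OF 1 2] unfolding 3 .
qed

text \<open>The ratio of consecutive terms is \<open>\<rho> ^ n * R\<close>, which tends to \<open>0\<close>.\<close>

lemma summable_on_theta_nat: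
  fixes \<rho> R :: real
  assumes "0 < \<rho>" "\<rho> < 1" "0 < R"
  shows "(\<lambda>n::nat. \<rho> powi binom2 (int n) * R ^ n) summable_on UNIV"
proof -
  define f where "f = (\<lambda>n::nat. \<rho> powi binom2 (int n) * R ^ n)"
  have pos: "f n > 0" for n using assms by (simp add: f_def)
  have "(\<lambda>n. \<rho> ^ n * R) \<longlonglongrightarrow> 0 * R"
    using assms by (intro tendsto_intros LIMSEQ_power_zero) auto
  hence "eventually (\<lambda>n. \<rho> ^ n * R < 1 / 2) sequentially"
    by (rule order_tendstoD) auto
  then obtain N where N: "\<And>n. n \<ge> N \<Longrightarrow> \<rho> ^ n * R < 1 / 2"
    unfolding eventually_sequentially by blast
  have step: "f (Suc n) = f n * (\<rho> ^ n * R)" for n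
  proof -
    have "binom2 (int (Suc n)) = binom2 (int n) + int n"
      using binom2_plus1[of "int n"] by (simp add: add.commute)
    thus ?thesis using assms by (simp add: f_def power_int_add)
  qed
  have "summable f"
  proof (rule summable_ratio_test[of "1/2" N])
    fix n assume "n \<ge> N"
    hence "f n * (\<rho> ^ n * R) \<le> f n * (1/2)"
      using N[of n] pos[of n] by (intro mult_left_mono) auto
    thus "norm (f (Suc n)) \<le> 1 / 2 * norm (f n)"
      using pos[of n] pos[of "Suc n"] by (simp add: step)
  qed simp
  hence "f summable_on UNIV"
    using pos by (intro norm_summable_imp_summable_on) (simp add: less_imp_le)
  thus ?thesis by (simp add: f_def)
qed

text \<open>Reflecting \<open>n\<close> turns the negative half into a series of the same kind, with \<open>\<rho> / R\<close> instead
  of \<open>R\<close>.\<close>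

lemma summable_on_theta_real:
  fixes \<rho> R :: real
  assumes "0 < \<rho>" "\<rho> < 1" "0 < R"
  shows "(\<lambda>n. \<rho> powi binom2 n * R powi n) summable_on UNIV"
proof (rule summable_on_int)
  show "(\<lambda>n. \<rho> powi binom2 (int n) * R powi int n) summable_on UNIV"
    using summable_on_theta_nat[OF assms] by simp
  have "(\<lambda>n::nat. \<rho> powi binom2 (int n) * (\<rho> / R) ^ n) summable_on UNIV"
    using assms by (intro summable_on_theta_nat) auto
  moreover have "\<rho> powi binom2 (int n) * (\<rho> / R) ^ n = \<rho> powi binom2 (- int n) * R powi (- int n)" for n
    using assms by (simp add: binom2_uminus power_int_add power_int_minus field_simps)
  ultimately show "(\<lambda>n. \<rho> powi binom2 (- int n) * R powi (- int n)) summable_on UNIV"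
    by simp
qed

lemma summable_on_theta:
  fixes q z :: complex and c :: "int \<Rightarrow> complex"
  assumes q: "norm q < 1" "q \<noteq> 0" and z: "z \<noteq> 0" and c: "\<And>n. norm (c n) \<le> C"
  shows "(\<lambda>n. c n * q powi binom2 n * z powi n) summable_on UNIV"
proof (rule abs_summable_summable, rule Infinite_Sum.abs_summable_on_comparison_test')
  show "(\<lambda>n. C * (norm q powi binom2 n * norm z powi n)) summable_on UNIV"
    using q z by (intro summable_on_cmult_right summable_on_theta_real) auto
  fix n :: int
  show "norm (c n * q powi binom2 n * z powi n) \<le> C * (norm q powi binom2 n * norm z powi n)"
    using c[of n] by (simp add: norm_mult norm_power_int mult.assoc mult_right_mono)
qed

text \<open>Tannery's theorem for sums over an arbitrary index set: the partial sums converge uniformly in the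
  parameter, so the two limits may be exchanged.\<close>

lemma tendsto_infsum_dominated:
  fixes f :: "'i \<Rightarrow> 'n \<Rightarrow> 'b :: banach"
  assumes bound: "\<And>i n. i \<in> I \<Longrightarrow> norm (f i n) \<le> M i"
    and M: "M summable_on I"
    and lim: "\<And>i. i \<in> I \<Longrightarrow> (f i \<longlongrightarrow> g i) F"
  shows "((\<lambda>n. \<Sum>\<^sub>\<infinity>i\<in>I. f i n) \<longlongrightarrow> (\<Sum>\<^sub>\<infinity>i\<in>I. g i)) F"
proof (cases "F = bot")
  case False
  have "norm (g i) \<le> M i" if "i \<in> I" for i
    by (rule Lim_norm_ubound[OF False lim[OF that]]) (use bound that in auto)
  hence "g abs_summable_on I"
    by (intro Infinite_Sum.abs_summable_on_comparison_test'[OF M]) auto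
  hence g: "g summable_on I" by (rule abs_summable_summable)
  show ?thesis
  proof (rule swap_uniform_limit')
    show "uniform_limit UNIV (\<lambda>X n. \<Sum>i\<in>X. f i n) (\<lambda>n. \<Sum>\<^sub>\<infinity>i\<in>I. f i n) (finite_subsets_at_top I)"
      by (rule Weierstrass_m_test_general[OF bound M])
    show "((\<lambda>X. \<Sum>i\<in>X. g i) \<longlongrightarrow> infsum g I) (finite_subsets_at_top I)"
      using g by (simp add: infsum_tendsto)
    show "\<forall>\<^sub>F X in finite_subsets_at_top I. ((\<lambda>n. \<Sum>i\<in>X. f i n) \<longlongrightarrow> (\<Sum>i\<in>X. g i)) F"
      by (intro eventually_finite_subsets_at_top_weakI tendsto_sum lim) auto
  qed auto
qed auto

text \<open>Weierstrass: locally uniform limits of the finite partial sums are holomorphic.\<close>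

lemma holomorphic_on_infsum:
  fixes f :: "'i \<Rightarrow> complex \<Rightarrow> complex"
  assumes S: "open S" and hol: "\<And>i. i \<in> I \<Longrightarrow> f i holomorphic_on S"
    and bound: "\<And>x. x \<in> S \<Longrightarrow> \<exists>d>0. \<exists>M. cball x d \<subseteq> S \<and> M summable_on I \<and>
                  (\<forall>i\<in>I. \<forall>y\<in>cball x d. norm (f i y) \<le> M i)"
  shows "(\<lambda>y. \<Sum>\<^sub>\<infinity>i\<in>I. f i y) holomorphic_on S"
proof -
  have "(\<lambda>y. \<Sum>\<^sub>\<infinity>i\<in>I. f i y) analytic_on {x}" if "x \<in> S" for x
  proof -
    from bound[OF that] obtain d M where d: "d > 0" "cball x d \<subseteq> S" and M: "M summable_on I"
      "\<And>i y. i \<in> I \<Longrightarrow> y \<in> cball x d \<Longrightarrow> norm (f i y) \<le> M i" by blast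
    have "uniform_limit (cball x d) (\<lambda>X y. \<Sum>i\<in>X. f i y) (\<lambda>y. \<Sum>\<^sub>\<infinity>i\<in>I. f i y) (finite_subsets_at_top I)"
      using M by (intro Weierstrass_m_test_general) auto
    moreover have "\<forall>\<^sub>F X in finite_subsets_at_top I. continuous_on (cball x d) (\<lambda>y. \<Sum>i\<in>X. f i y) \<and>
                     (\<lambda>y. \<Sum>i\<in>X. f i y) holomorphic_on ball x d"
    proof (intro eventually_finite_subsets_at_top_weakI)
      fix X assume X: "finite X" "X \<subseteq> I"
      hence "(\<lambda>y. \<Sum>i\<in>X. f i y) holomorphic_on S"
        by (intro holomorphic_intros hol) auto
      moreover have "ball x d \<subseteq> S" using d ball_subset_cball by blast
      ultimately show "continuous_on (cball x d) (\<lambda>y. \<Sum>i\<in>X. f i y) \<and>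
                     (\<lambda>y. \<Sum>i\<in>X. f i y) holomorphic_on ball x d"
        using d by (meson continuous_on_subset holomorphic_on_imp_continuous_on holomorphic_on_subset)
    qed
    ultimately have "(\<lambda>y. \<Sum>\<^sub>\<infinity>i\<in>I. f i y) holomorphic_on ball x d"
      by (rule_tac holomorphic_uniform_limit) auto
    thus ?thesis using d by (auto simp: analytic_at intro!: exI[of _ "ball x d"])
  qed
  hence "(\<lambda>y. \<Sum>\<^sub>\<infinity>i\<in>I. f i y) analytic_on S"
    by (subst analytic_on_analytic_at) simp
  thus ?thesis by (rule analytic_imp_holomorphic)
qed

lemma has_sum_diff:
  fixes f g :: "'a \<Rightarrow> complex"
  assumes "(f has_sum a) A" "(g has_sum b) A"
  shows "((\<lambda>x. f x - g x) has_sum (a - b)) A"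
  using has_sum_add[OF assms(1) has_sum_cmult_right[OF assms(2), of "-1"]] by simp

text \<open>A series over a single row or column of the lattice, extended by \<open>0\<close>. With its analogue for columns it
  lets the strips on which a shift changes the sign factor be subtracted from the double sum one at a
  time.\<close>

lemma has_sum_row:
  assumes "(g has_sum S) UNIV"
  shows "((\<lambda>(r, s). if r = j then g s else 0) has_sum S) UNIV"
proof -
  have "((\<lambda>(r, s). if r = j then g s else 0) has_sum S) (range (Pair j))"
    using assms by (subst has_sum_reindex) (auto simp: o_def inj_on_def)
  thus ?thesis
    by (rule has_sum_cong_neutral[THEN iffD1, rotated -1]) auto
qed

lemma has_sum_column:
  assumes "(g has_sum S) UNIV"
  shows "((\<lambda>(r, s). if s = j then g r else 0) has_sum S) UNIV"
proof -
  have "((\<lambda>(r, s). if s = j then g r else 0) has_sum S) (range (\<lambda>r. (r, j)))"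
    using assms by (subst has_sum_reindex) (auto simp: o_def inj_on_def)
  thus ?thesis
    by (rule has_sum_cong_neutral[THEN iffD1, rotated -1]) auto
qed

section \<open>The Jacobi triple product\<close>

text \<open>The Gaussian binomial coefficient, by its Pascal recursion. The exponent \<open>n - k\<close> is truncated only
  for \<open>k > n\<close>, where the coefficient that it multiplies is \<open>0\<close>.\<close>

fun qbinom :: "complex \<Rightarrow> nat \<Rightarrow> nat \<Rightarrow> complex" where
  "qbinom q n 0 = 1"
| "qbinom q 0 (Suc k) = 0"
| "qbinom q (Suc n) (Suc k) = qbinom q n (Suc k) + q ^ (n - k) * qbinom q n k"

definition qfact :: "complex \<Rightarrow> nat \<Rightarrow> complex" where
  "qfact q n = (\<Prod>i<n. 1 - q * q ^ i)"

lemma qfact_0 [simp]: "qfact q 0 = 1" and qfact_Suc: "qfact q (Suc n) = qfact q n * (1 - q ^ Suc n)"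
  by (simp_all add: qfact_def)

lemma qbinom_eq_0: "n < k \<Longrightarrow> qbinom q n k = 0"
  by (induction q n k rule: qbinom.induct) auto

lemma qbinom_self: "qbinom q n n = 1"
  by (induction n) (auto simp: qbinom_eq_0)

lemma qbinom_mult_qfact:
  "k \<le> n \<Longrightarrow> qbinom q n k * (qfact q k * qfact q (n - k)) = qfact q n"
proof (induction n arbitrary: k)
  case (Suc n)
  show ?case
  proof (cases k)
    case k: (Suc k')
    show ?thesis
    proof (cases "k' = n")
      case True
      thus ?thesis using k by (simp add: qbinom_eq_0 qbinom_self)
    next
      case False
      then obtain d where d: "n = Suc (k' + d)"
        using Suc.prems k by (metis Suc_le_mono le_neq_implies_less less_imp_Suc_add)
      have 1: "qbinom q n (Suc k') * (qfact q (Suc k') * qfact q d) = qfact q n"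
        using Suc.IH[of "Suc k'"] d by simp
      have 2: "qbinom q n k' * (qfact q k' * qfact q (Suc d)) = qfact q n"
        using Suc.IH[of k'] d by (simp add: Suc_diff_le)
      have "qbinom q (Suc n) k * (qfact q k * qfact q (Suc n - k)) =
         (qbinom q n (Suc k') * (qfact q (Suc k') * qfact q d)) * (1 - q ^ Suc d) +
         q ^ Suc d * (qbinom q n k' * (qfact q k' * qfact q (Suc d))) * (1 - q ^ Suc k')"
        using k d by (simp add: qfact_Suc algebra_simps)
      also have "\<dots> = qfact q n * (1 - q ^ (Suc d + Suc k'))"
        unfolding 1 2 power_add by (simp add: algebra_simps)
      also have "\<dots> = qfact q (Suc n)"
        using d by (simp add: qfact_Suc add.commute)
      finally show ?thesis .
    qed
  qed simp
qed simp

text \<open>The \<open>q\<close>-binomial theorem. In the induction the factor \<open>1 - y * q ^ n\<close> combines the coefficients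
  exactly as in the Pascal recursion.\<close>

lemma rothe_identity:
  assumes "q \<noteq> 0"
  shows "(\<Prod>i<n. 1 - y * q ^ i) = (\<Sum>k\<le>n. (-1) ^ k * q powi binom2 (int k) * qbinom q n k * y ^ k)"
proof (induction n)
  case (Suc n)
  let ?c = "\<lambda>n k. (-1) ^ k * q powi binom2 (int k) * qbinom q n k * y ^ k"
  have step: "?c (Suc n) (Suc k) = ?c n (Suc k) - y * q ^ n * ?c n k" if "k \<le> n" for k
  proof -
    have "binom2 (int (Suc k)) = binom2 (int k) + int k"
      using binom2_plus1[of "int k"] by (simp add: add.commute)
    hence "q powi binom2 (int (Suc k)) = q powi binom2 (int k) * q ^ k"
      using assms by (simp add: power_int_add)
    moreover have "q ^ k * q ^ (n - k) = q ^ n"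
      using that by (simp flip: power_add)
    ultimately show ?thesis by (simp add: algebra_simps)
  qed
  have "(\<Sum>k\<le>Suc n. ?c (Suc n) k) = ?c (Suc n) 0 + (\<Sum>k\<le>n. ?c (Suc n) (Suc k))"
    by (rule sum.atMost_Suc_shift)
  also have "(\<Sum>k\<le>n. ?c (Suc n) (Suc k)) = (\<Sum>k\<le>n. ?c n (Suc k)) - y * q ^ n * (\<Sum>k\<le>n. ?c n k)"
    unfolding sum_distrib_left sum_subtractf[symmetric] by (intro sum.cong refl step) auto
  also have "?c (Suc n) 0 + \<dots> = (\<Sum>k\<le>Suc n. ?c n k) - y * q ^ n * (\<Sum>k\<le>n. ?c n k)"
    unfolding sum.atMost_Suc_shift[of "?c n" n] by simp
  also have "(\<Sum>k\<le>Suc n. ?c n k) = (\<Sum>k\<le>n. ?c n k)"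
    by (simp add: qbinom_eq_0)
  finally show ?case
    using Suc.IH by (simp add: algebra_simps)
qed simp

text \<open>Rothe's identity with \<open>2 * N\<close> factors at \<open>y = x / q ^ N\<close>: half of the factors are
  \<open>1 - x * q ^ i\<close>, the other half become \<open>1 - q / x * q ^ i\<close> after extraction of the monomial
  \<open>- x / q ^ Suc i\<close>. The product of these monomials, \<open>w\<close>, cancels when the summation index is
  centred.\<close>

lemma finite_jacobi_triple_product:
  assumes "q \<noteq> 0" "x \<noteq> 0"
  shows "(\<Prod>i<N. 1 - x * q ^ i) * (\<Prod>i<N. 1 - q / x * q ^ i) =
           (\<Sum>n = -int N..int N. (-1) powi n * q powi binom2 n * x powi n * qbinom q (2*N) (nat (int N + n)))"
proof -
  define y where "y = x / q ^ N"
  \<comment> \<open>the product of the monomials \<open>- x / q ^ Suc i\<close> over \<open>i < N\<close>\<close>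
  define w where "w = (-1) ^ N * x ^ N * q powi (- binom2 (int N) - int N)"
  have w: "w \<noteq> 0" using assms by (simp add: w_def)
  have shift: "(\<Prod>i<2*N. 1 - y * q ^ i) = w * ((\<Prod>i<N. 1 - x * q ^ i) * (\<Prod>i<N. 1 - q / x * q ^ i))"
  proof -
    have "(\<Prod>i<2*N. 1 - y * q ^ i) = (\<Prod>i<N. 1 - y * q ^ i) * (\<Prod>i=N..<2*N. 1 - y * q ^ i)"
      using prod.atLeastLessThan_concat[of 0 N "2*N" "\<lambda>i. 1 - y * q ^ i"] by (simp add: lessThan_atLeast0)
    also have "(\<Prod>i=N..<2*N. 1 - y * q ^ i) = (\<Prod>i<N. 1 - x * q ^ i)"
      by (rule prod.reindex_bij_witness[of _ "\<lambda>i. i + N" "\<lambda>i. i - N"])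
         (use assms in \<open>auto simp: y_def power_diff\<close>)
    also have "(\<Prod>i<N. 1 - y * q ^ i) = (\<Prod>i<N. 1 - x / q ^ Suc i)"
    proof (rule prod.reindex_bij_witness[of _ "\<lambda>i. N - Suc i" "\<lambda>i. N - Suc i"])
      fix i assume "i \<in> {..<N}"
      hence "q ^ i * q ^ Suc (N - Suc i) = q ^ N"
        unfolding power_add[symmetric] by (intro arg_cong[where f = "\<lambda>k. q ^ k"]) auto
      hence "q ^ N = q ^ Suc (N - Suc i) * q ^ i" by (simp only: mult.commute)
      thus "1 - x / q ^ Suc (N - Suc i) = 1 - y * q ^ i"
        using assms by (simp add: y_def)
    qed auto
    also have "(\<Prod>i<N. 1 - x / q ^ Suc i) = (\<Prod>i<N. (- x / q ^ Suc i) * (1 - q / x * q ^ i))"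
      using assms by (intro prod.cong) (auto simp: field_simps)
    also have "\<dots> = (\<Prod>i<N. - x / q ^ Suc i) * (\<Prod>i<N. 1 - q / x * q ^ i)"
      by (rule prod.distrib)
    also have "(\<Prod>i<N. - x / q ^ Suc i) = w"
      unfolding w_def
    proof (induction N)
      case (Suc N)
      have "binom2 (int (Suc N)) = binom2 (int N) + int N"
        using binom2_plus1[of "int N"] by (simp add: add.commute)
      hence "- binom2 (int (Suc N)) - int (Suc N) = (- binom2 (int N) - int N) - int (Suc N)" by simp
      hence "q powi (- binom2 (int (Suc N)) - int (Suc N)) = q powi (- binom2 (int N) - int N) / q ^ Suc N"
        using assms by (simp only: power_int_diff power_int_of_nat simp_thms)
      thus ?case unfolding prod.lessThan_Suc Suc.IH by simp
    qed simp
    finally show ?thesis by (simp add: mult_ac)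
  qed
  have "(\<Sum>k\<le>2*N. (-1) ^ k * q powi binom2 (int k) * qbinom q (2*N) k * y ^ k) =
        (\<Sum>n = -int N..int N. w * ((-1) powi n * q powi binom2 n * x powi n * qbinom q (2*N) (nat (int N + n))))"
  proof (rule sum.reindex_bij_witness[of _ "\<lambda>n. nat (int N + n)" "\<lambda>k. int k - int N"])
    fix k assume "k \<in> {..2*N}"
    define n where "n = int k - int N"
    have k: "int k = n + int N" by (simp add: n_def)
    have "y ^ k = x powi (n + int N) * q powi (- int N * (n + int N))"
    proof -
      have "y ^ k = (x * q powi (- int N)) powi int k"
        by (simp add: y_def power_int_minus field_simps)
      thus ?thesis unfolding power_int_mult_distrib power_int_mult[symmetric] k .
    qed
    hence "(-1) ^ k * q powi binom2 (int k) * y ^ k =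
       ((-1) powi (n + int N) * x powi (n + int N)) * q powi (binom2 (int k) - int N * (n + int N))"
      using assms by (simp add: power_int_diff power_int_minus field_simps flip: k)
    also have "binom2 (int k) - int N * (n + int N) = binom2 n + (- binom2 (int N) - int N)"
      unfolding k using binom2_double[of n] binom2_double[of "int N"] binom2_double[of "n + int N"]
      by (simp add: algebra_simps)
    also have "((-1) powi (n + int N) * x powi (n + int N)) * q powi \<dots> =
      w * ((-1) powi n * q powi binom2 n * x powi n)"
      unfolding w_def using assms by (subst (1 2 3) power_int_add) auto
    finally show "w * ((-1) powi (int k - int N) * q powi binom2 (int k - int N) * x powi (int k - int N) *
         qbinom q (2*N) (nat (int N + (int k - int N)))) =
         (-1) ^ k * q powi binom2 (int k) * qbinom q (2*N) k * y ^ k"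
      by (simp add: n_def mult_ac)
  qed auto
  hence "w * ((\<Prod>i<N. 1 - x * q ^ i) * (\<Prod>i<N. 1 - q / x * q ^ i)) =
        w * (\<Sum>n = -int N..int N. (-1) powi n * q powi binom2 n * x powi n * qbinom q (2*N) (nat (int N + n)))"
    unfolding shift[symmetric] sum_distrib_left using rothe_identity[OF assms(1), of y "2*N"] by simp
  thus ?thesis using w by simp
qed

lemma qfact_LIMSEQ: "norm q < 1 \<Longrightarrow> qfact q \<longlonglongrightarrow> qpoch_inf q q"
  using qpoch_inf_LIMSEQ[of q q] unfolding qfact_def[abs_def] .

lemma qfact_nonzero: "norm q < 1 \<Longrightarrow> qfact q n \<noteq> 0"
  using qpoch_inf_self_nonzero[of q] qpoch_inf_eq_0_iff[of q q]
  by (auto simp: qfact_def)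

lemma qbinom_conv_qfact:
  assumes "norm q < 1" "k \<le> n"
  shows "qbinom q n k = qfact q n / (qfact q k * qfact q (n - k))"
  using qbinom_mult_qfact[OF assms(2), of q] qfact_nonzero[OF assms(1)] by (simp add: field_simps)

text \<open>Both \<open>qfact q n\<close> and its reciprocal converge, so both are bounded. The bound is uniform in \<open>n\<close> and
  \<open>k\<close>, as dominated convergence requires.\<close>

lemma qbinom_bounded:
  assumes "norm q < 1"
  shows "\<exists>C. \<forall>n k. norm (qbinom q n k) \<le> C"
proof -
  have "Bseq (qfact q)"
    using qfact_LIMSEQ[OF assms] by (intro convergent_imp_Bseq convergentI)
  then obtain B where B: "B > 0" "\<And>n. norm (qfact q n) \<le> B" by (auto elim: BseqE)
  have "(\<lambda>n. inverse (qfact q n)) \<longlonglongrightarrow> inverse (qpoch_inf q q)"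
    by (intro tendsto_inverse qfact_LIMSEQ qpoch_inf_self_nonzero assms)
  hence "Bseq (\<lambda>n. inverse (qfact q n))" by (intro convergent_imp_Bseq convergentI)
  then obtain D where D: "D > 0" "\<And>n. norm (inverse (qfact q n)) \<le> D" by (auto elim: BseqE)
  have "norm (qbinom q n k) \<le> B * (D * D)" for n k
  proof (cases "k \<le> n")
    case True
    have "qbinom q n k = qfact q n * (inverse (qfact q k) * inverse (qfact q (n - k)))"
      using qbinom_conv_qfact[OF assms True] by (simp add: field_simps)
    thus ?thesis unfolding norm_mult
      using B D by (auto simp: norm_mult intro!: mult_mono)
  qed (use B D in \<open>auto simp: qbinom_eq_0\<close>)
  thus ?thesis by blast
qed

text \<open>In the finite form the coefficient \<open>qbinom q (2 * N) (N + n)\<close> tends to \<open>1 / qpoch_inf q q\<close> for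
  each fixed \<open>n\<close> and is bounded in both variables.\<close>

theorem jacobi_triple_product:
  assumes "norm q < 1" "q \<noteq> 0" "x \<noteq> 0"
  shows "(\<Sum>\<^sub>\<infinity>n. (-1) powi n * q powi binom2 n * x powi n) = Theta x q"
proof -
  define a where "a n = (-1) powi n * q powi binom2 n * x powi n" for n :: int
  define f where "f n N = (if n \<in> {-int N..int N} then a n * qbinom q (2*N) (nat (int N + n)) else 0)"
    for n :: int and N :: nat
  obtain C where C: "\<And>n k. norm (qbinom q n k) \<le> C" using qbinom_bounded[OF assms(1)] by blast
  have C0: "C \<ge> 0" using C[of 0 0] by simp
  have 1: "(\<lambda>N. \<Sum>\<^sub>\<infinity>n. f n N) \<longlonglongrightarrow> (\<Sum>\<^sub>\<infinity>n. a n / qpoch_inf q q)"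
  proof (rule tendsto_infsum_dominated)
    show "(\<lambda>n. C * (norm q powi binom2 n * norm x powi n)) summable_on UNIV"
      using assms by (intro summable_on_cmult_right summable_on_theta_real) auto
    show "norm (f n N) \<le> C * (norm q powi binom2 n * norm x powi n)" for n N
    proof -
      have "norm (f n N) \<le> norm (a n) * C"
        using C[of "2*N" "nat (int N + n)"] C0
        by (auto simp: f_def norm_mult intro!: mult_left_mono)
      thus ?thesis by (simp add: a_def norm_mult norm_power_int mult_ac)
    qed
    show "f n \<longlonglongrightarrow> a n / qpoch_inf q q" for n
    proof -
      have g: "filterlim (\<lambda>N. nat (int N + n)) sequentially sequentially" for n :: int
      proof (rule filterlim_at_top_mono[where f = "\<lambda>N. N - nat (-n)"])
        show "filterlim (\<lambda>N. N - nat (-n)) sequentially sequentially" by (rule filterlim_minus_const_nat_at_top)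
      qed (auto intro!: always_eventually)
      have "filterlim (\<lambda>N::nat. 2 * N) sequentially sequentially"
        by (intro filterlim_subseq) (simp add: strict_mono_def)
      from filterlim_compose[OF qfact_LIMSEQ[OF assms(1)] this]
      have lim1: "(\<lambda>N. qfact q (2 * N)) \<longlonglongrightarrow> qpoch_inf q q" .
      have lim2: "(\<lambda>N. qfact q (nat (int N + n))) \<longlonglongrightarrow> qpoch_inf q q" for n :: int
        using filterlim_compose[OF qfact_LIMSEQ[OF assms(1)] g] .
      have "(\<lambda>N. a n * (qfact q (2*N) / (qfact q (nat (int N + n)) * qfact q (nat (int N + (-n))))))
               \<longlonglongrightarrow> a n * (qpoch_inf q q / (qpoch_inf q q * qpoch_inf q q))"
        using qpoch_inf_self_nonzero[OF assms(1)]
        by (intro tendsto_mult tendsto_divide tendsto_const lim1 lim2) auto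
      moreover have "eventually (\<lambda>N. a n * (qfact q (2*N) / (qfact q (nat (int N + n)) * qfact q (nat (int N + (-n)))))
          = f n N) sequentially"
        using eventually_ge_at_top[of "nat \<bar>n\<bar>"]
      proof eventually_elim
        case (elim N)
        hence "n \<in> {-int N..int N}" by auto
        moreover from this have "nat (int N + n) \<le> 2 * N" "2 * N - nat (int N + n) = nat (int N + (-n))" by auto
        ultimately show ?case by (simp add: f_def qbinom_conv_qfact[OF assms(1)])
      qed
      ultimately show ?thesis
        using qpoch_inf_self_nonzero[OF assms(1)] by (auto dest: Lim_transform_eventually)
    qed
  qed
  have prods: "(\<Sum>\<^sub>\<infinity>n. f n N) = (\<Prod>i<N. 1 - x * q ^ i) * (\<Prod>i<N. 1 - q / x * q ^ i)" for N
  proof -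
    have "(\<Sum>\<^sub>\<infinity>n. f n N) = (\<Sum>\<^sub>\<infinity>n\<in>{-int N..int N}. a n * qbinom q (2*N) (nat (int N + n)))"
      by (rule infsum_cong_neutral) (auto simp: f_def)
    thus ?thesis using finite_jacobi_triple_product[OF assms(2,3), of N] by (simp add: a_def)
  qed
  have "(\<lambda>N. \<Sum>\<^sub>\<infinity>n. f n N) \<longlonglongrightarrow> qpoch_inf x q * qpoch_inf (q / x) q"
    unfolding prods by (intro tendsto_mult qpoch_inf_LIMSEQ assms)
  from LIMSEQ_unique[OF 1 this]
  have "(\<Sum>\<^sub>\<infinity>n. a n) / qpoch_inf q q = qpoch_inf x q * qpoch_inf (q / x) q"
    by (simp add: divide_inverse infsum_cmult_left')
  thus ?thesis
    using qpoch_inf_self_nonzero[OF assms(1)] by (simp add: a_def Theta_def field_simps)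
qed

lemma jacobi_triple_product_has_sum:
  assumes "norm q < 1" "q \<noteq> 0" "x \<noteq> 0"
  shows "((\<lambda>n. (-1) powi n * q powi binom2 n * x powi n) has_sum Theta x q) UNIV"
proof -
  have "(\<lambda>n. (-1) powi n * q powi binom2 n * x powi n) summable_on UNIV"
    by (rule summable_on_theta[OF assms, where C = 1]) (simp add: norm_power_int)
  thus ?thesis
    using jacobi_triple_product[OF assms] by (metis has_sum_infsum)
qed

section \<open>The Hecke-type double sum\<close>

text \<open>The monomials of \<open>hecke_f 1 2 3 (q\<^sup>2 / x) (q ^ 3) q\<close> without the sign factor \<open>sg2\<close>. In terms of \<open>n = r + s\<close> the exponent of \<open>q\<close> is \<open>n * (n + 3) / 2 + n * s\<close>.\<close>

definition hecke_term :: "complex \<Rightarrow> complex \<Rightarrow> int \<times> int \<Rightarrow> complex" where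
  "hecke_term q x = (\<lambda>(r, s). (-1) powi (r + s) * x powi (- r) *
      q powi (binom2 r + 2 * r + 2 * r * s + 3 * binom2 s + 3 * s))"

definition hecke123 :: "complex \<Rightarrow> complex \<Rightarrow> complex" where
  "hecke123 q x = (\<Sum>\<^sub>\<infinity>(r, s). sg2 r s * hecke_term q x (r, s))"

lemma hecke_f_eq_hecke123:
  assumes "q \<noteq> 0" "x \<noteq> 0"
  shows "hecke_f 1 2 3 (x powi (-1) * q ^ 2) (q ^ 3) q = hecke123 q x"
  unfolding hecke_f_def hecke123_def hecke_term_def
proof (intro infsum_cong)
  fix p :: "int \<times> int"
  obtain r s where p: "p = (r, s)" by (cases p)
  have "(x powi (-1) * q ^ 2) powi r = x powi (- r) * q powi (2 * r)"
    by (simp add: power_int_mult_distrib power_int_mult power_int_minus power_int_inverse)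
  moreover have "(q ^ 3) powi s = q powi (3 * s)"
    by (simp add: power_int_mult)
  ultimately show "(case p of (r, s) \<Rightarrow> sg2 r s * (-1) powi (r + s) * (x powi (-1) * q ^ 2) powi r *
      (q ^ 3) powi s * q powi (int 1 * binom2 r + int 2 * r * s + int 3 * binom2 s)) =
    (case p of (r, s) \<Rightarrow> sg2 r s * (case (r, s) of (r, s) \<Rightarrow> (-1) powi (r + s) * x powi (- r) *
      q powi (binom2 r + 2 * r + 2 * r * s + 3 * binom2 s + 3 * s)))"
    using assms by (simp add: p power_int_add)
qed

definition hecke_majorant :: "real \<Rightarrow> real \<Rightarrow> real \<Rightarrow> int \<times> int \<Rightarrow> real" where
  "hecke_majorant \<rho> a b = (\<lambda>(r, s).
     (\<rho> powi binom2 r * (\<rho>\<^sup>2 / a) powi r + \<rho> powi binom2 r * (\<rho>\<^sup>2 / b) powi r) *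
     ((\<rho> ^ 3) powi binom2 s * (\<rho> ^ 3) powi s))"

lemma hecke_majorant_summable:
  assumes "0 < \<rho>" "\<rho> < 1" "0 < a" "0 < b"
  shows "hecke_majorant \<rho> a b summable_on UNIV"
proof -
  define u where "u r = \<rho> powi binom2 r * (\<rho>\<^sup>2 / a) powi r + \<rho> powi binom2 r * (\<rho>\<^sup>2 / b) powi r" for r :: int
  define v where "v s = (\<rho> ^ 3) powi binom2 s * (\<rho> ^ 3) powi s" for s :: int
  have u: "u summable_on UNIV"
    unfolding u_def using assms by (intro summable_on_add summable_on_theta_real) auto
  have v: "v summable_on UNIV"
    unfolding v_def using assms by (intro summable_on_theta_real) (auto simp: power_less_one_iff)
  have pos: "u r \<ge> 0" "v s \<ge> 0" for r s
    using assms by (auto simp: u_def v_def)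
  have "(\<lambda>p. norm ((\<lambda>(r, s). u r * v s) p)) summable_on (UNIV \<times> UNIV)"
    unfolding Infinite_Sum.abs_summable_on_Sigma_iff
    using u v pos by (auto simp: abs_mult summable_on_cmult_right infsum_cmult_right summable_on_cmult_left infsum_nonneg)
  thus ?thesis
    using abs_summable_summable by (fastforce simp: hecke_majorant_def u_def v_def)
qed

lemma hecke_majorant:
  assumes q: "norm q < 1" "q \<noteq> 0" and x: "0 < a" "a \<le> norm x" "norm x \<le> b"
  shows "norm (sg2 r s * hecke_term q x (r, s)) \<le> hecke_majorant (norm q) a b (r, s)"
proof (cases "sg r = sg s")
  case False
  hence "sg2 r s = 0" by (auto simp: sg2_def sg_def split: if_splits)
  thus ?thesis using assms by (simp add: hecke_majorant_def)
next
  case True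
  define \<rho> where "\<rho> = norm q"
  have \<rho>: "0 < \<rho>" "\<rho> < 1" using q by (auto simp: \<rho>_def)
  \<comment> \<open>for equal signs the mixed factor \<open>q powi (2 * r * s)\<close> only helps, and a product of theta terms remains\<close>
  have "r * s \<ge> 0"
    using True by (auto simp: sg_def zero_le_mult_iff split: if_splits)
  hence le: "\<rho> powi (2 * r * s) \<le> 1"
    using \<rho> by (simp add: power_int_def power_le_one)
  have "norm x powi (- r) \<le> a powi (- r) + b powi (- r)"
    using x by (rule power_int_le_add_endpoints)
  hence "norm x powi (- r) * \<rho> powi (2 * r * s) \<le> (a powi (- r) + b powi (- r)) * 1"
    using le x \<rho> by (intro mult_mono) auto
  hence "(\<rho> powi binom2 r * \<rho> powi (2 * r) * \<rho> powi (3 * binom2 s) * \<rho> powi (3 * s)) *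
          (norm x powi (- r) * \<rho> powi (2 * r * s))
      \<le> (\<rho> powi binom2 r * \<rho> powi (2 * r) * \<rho> powi (3 * binom2 s) * \<rho> powi (3 * s)) *
          ((a powi (- r) + b powi (- r)) * 1)"
    using \<rho> by (intro mult_left_mono) auto
  also have "\<dots> = hecke_majorant \<rho> a b (r, s)"
  proof -
    have "(\<rho> ^ 2) powi n = \<rho> powi (2 * n)" "(\<rho> ^ 3) powi n = \<rho> powi (3 * n)" for n
      by (simp_all add: power_int_mult)
    thus ?thesis
      by (simp add: hecke_majorant_def power_int_divide_distrib power_int_minus field_simps)
  qed
  also have "norm (sg2 r s) = 1"
    using True by (auto simp: sg2_def sg_def)
  hence "(\<rho> powi binom2 r * \<rho> powi (2 * r) * \<rho> powi (3 * binom2 s) * \<rho> powi (3 * s)) *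
          (norm x powi (- r) * \<rho> powi (2 * r * s)) = norm (sg2 r s * hecke_term q x (r, s))"
    using q by (simp add: hecke_term_def norm_mult norm_power_int power_int_add flip: \<rho>_def)
  finally show ?thesis by (simp add: \<rho>_def)
qed

lemma hecke_summable:
  assumes "norm q < 1" "q \<noteq> 0" "x \<noteq> 0"
  shows "(\<lambda>(r, s). sg2 r s * hecke_term q x (r, s)) summable_on UNIV"
proof (rule abs_summable_summable, rule Infinite_Sum.abs_summable_on_comparison_test')
  show "hecke_majorant (norm q) (norm x) (norm x) summable_on UNIV"
    using assms by (intro hecke_majorant_summable) auto
qed (use assms hecke_majorant[of q "norm x" x "norm x"] in auto)

lemma hecke123_holomorphic:
  assumes q: "norm q < 1" "q \<noteq> 0"
  shows "hecke123 q holomorphic_on -{0}"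
proof -
  have "(\<lambda>x. \<Sum>\<^sub>\<infinity>p. sg2 (fst p) (snd p) * hecke_term q x p) holomorphic_on -{0}"
  proof (rule holomorphic_on_infsum)
    fix p
    show "(\<lambda>x. sg2 (fst p) (snd p) * hecke_term q x p) holomorphic_on -{0}"
      unfolding hecke_term_def by (cases p) (auto intro!: holomorphic_intros)
  next
    fix x :: complex assume "x \<in> -{0}"
    hence x: "norm x / 2 > 0" by simp
    have "hecke_majorant (norm q) (norm x / 2) (2 * norm x) summable_on UNIV"
      using q x by (intro hecke_majorant_summable) auto
    moreover have "cball x (norm x / 2) \<subseteq> -{0}"
      using x ball_half_norm(1)[of 0 x] by auto
    moreover have "\<forall>p\<in>UNIV. \<forall>y\<in>cball x (norm x / 2). norm (sg2 (fst p) (snd p) * hecke_term q y p)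
        \<le> hecke_majorant (norm q) (norm x / 2) (2 * norm x) p"
      using hecke_majorant[OF q x ball_half_norm] by auto
    ultimately show "\<exists>d>0. \<exists>M. cball x d \<subseteq> -{0} \<and> M summable_on UNIV \<and>
        (\<forall>p\<in>UNIV. \<forall>y\<in>cball x d. norm (sg2 (fst p) (snd p) * hecke_term q y p) \<le> M p)"
      using x by blast
  qed auto
  moreover have "(\<lambda>p. sg2 (fst p) (snd p) * hecke_term q x p) = (\<lambda>(r, s). sg2 r s * hecke_term q x (r, s))" for x
    by auto
  ultimately show ?thesis
    by (simp add: hecke123_def[abs_def])
qed

lemma sg_shift:
  "sg (r - 3) = sg r - 2 * of_bool (r = 0) - 2 * of_bool (r = 1) - 2 * of_bool (r = 2)"
  "sg (s + 2) = sg s + 2 * of_bool (s = -1) + 2 * of_bool (s = -2)"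
  by (auto simp: sg_def)

lemma sg2_shift:
  "sg2 (r - 3) (s + 2) = sg2 r s - of_bool (r = 0) - of_bool (r = 1) - of_bool (r = 2)
     + of_bool (s = -1) + of_bool (s = -2)"
  unfolding sg2_def sg_shift by simp

lemma hecke_term_shift:
  assumes "q \<noteq> 0" "x \<noteq> 0"
  shows "hecke_term q (q * x) (r - 3, s + 2) = - (x ^ 3) * hecke_term q x (r, s)"
proof -
  define E where "E r s = binom2 r + 2 * r + 2 * r * s + 3 * binom2 s + 3 * s" for r s
  \<comment> \<open>with \<open>n = r + s\<close>, \<open>E r s = n * (n + 3) / 2 + n * s\<close>; the step lowers \<open>n\<close> by \<open>1\<close> and raises \<open>s\<close> by \<open>2\<close>\<close>
  have "E (r - 3) (s + 2) - (r - 3) = E r s"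
    unfolding E_def using binom2_add[of r "-3"] binom2_add[of s 2]
    by (simp add: algebra_simps) (simp add: binom2_def)
  hence "q powi (3 - r) * q powi E (r - 3) (s + 2) = q powi E r s"
    using assms by (simp flip: power_int_add add: algebra_simps)
  moreover have "(-1) powi (r - 3 + (s + 2)) = - ((-1) powi (r + s) :: complex)"
    by (simp add: power_int_add power_int_diff)
  moreover have "x powi (3 - r) = x ^ 3 * x powi (- r)"
    using assms by (simp add: power_int_diff power_int_minus field_simps)
  ultimately show ?thesis
    unfolding hecke_term_def E_def by (simp add: power_int_mult_distrib mult_ac)
qed

text \<open>Along a line \<open>r = j\<close> the exponent of \<open>q\<close> is \<open>3 * binom2 s\<close> plus a linear term, along a line
  \<open>s = j\<close> it is \<open>binom2 r\<close> plus a linear term. So each strip is a theta series in base \<open>q ^ 3\<close> or \<open>q\<close>,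
  and quasi-periodicity brings its argument to \<open>1\<close>, \<open>q\<close> or \<open>q ^ 2\<close>, respectively \<open>1 / x\<close>.\<close>

lemma hecke_term_strip_sums:
  assumes q: "norm q < 1" "q \<noteq> 0" and x: "x \<noteq> 0"
  shows "((\<lambda>s. hecke_term q x (0, s)) has_sum 0) UNIV"
    "((\<lambda>s. hecke_term q x (1, s)) has_sum (qpoch_inf q q / x)) UNIV"
    "((\<lambda>s. hecke_term q x (2, s)) has_sum (qpoch_inf q q / x ^ 2)) UNIV"
    "((\<lambda>r. hecke_term q x (r, -1)) has_sum (Theta x q / x)) UNIV"
    "((\<lambda>r. hecke_term q x (r, -2)) has_sum (- Theta x q / x ^ 3)) UNIV"
proof -
  have q3: "norm (q ^ 3) < 1" "q ^ 3 \<noteq> 0" using q by (auto intro: norm_power_lt_1)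
  note J3 = jacobi_triple_product_has_sum[OF q3]
  have e: "binom2 2 = 1" "binom2 (-1) = 1" "binom2 (-2) = 3" by (simp_all add: binom2_def)
  have p3: "(q ^ 3) powi n = q powi (3 * n)" "(q ^ k) powi n = q powi (int k * n)" for n k
    by (simp_all add: power_int_mult)
  have T3: "Theta (q ^ (k + 3)) (q ^ 3) = - Theta (q ^ k) (q ^ 3) / q ^ k" for k
    using Theta_mult_q[OF q3, of "q ^ k"] q by (simp add: power_add mult.commute)
  have "Theta (q ^ 3) (q ^ 3) = 0"
    using Theta_eq_0_iff[OF q3, of "q ^ 3"] q by (metis power_int_1_right q3(2))
  with J3[of "q ^ 3"] q show "((\<lambda>s. hecke_term q x (0, s)) has_sum 0) UNIV"
    by (simp add: hecke_term_def power_int_add p3 mult_ac)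
  have "((\<lambda>s. - q\<^sup>2 / x * ((-1) powi s * (q ^ 3) powi binom2 s * (q ^ 5) powi s))
           has_sum (- q\<^sup>2 / x * Theta (q ^ 5) (q ^ 3))) UNIV"
    using q by (intro has_sum_cmult_right J3) auto
  moreover have "- q\<^sup>2 / x * Theta (q ^ 5) (q ^ 3) = qpoch_inf q q / x"
  proof -
    have "Theta (q ^ 5) (q ^ 3) = - qpoch_inf q q / q\<^sup>2"
      using T3[of 2] unfolding Theta_cubed_base[OF q] by (simp only: numeral_plus_numeral semiring_norm)
    thus ?thesis using q(2) by (simp only:) (simp add: field_simps)
  qed
  moreover have "- q\<^sup>2 / x * ((-1) powi s * (q ^ 3) powi binom2 s * (q ^ 5) powi s) = hecke_term q x (1, s)" for s
  proof -
    have "2 + 2 * s + 3 * binom2 s + 3 * s = 2 + 3 * binom2 s + 5 * s" by simp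
    hence "q powi (2 + 2 * s + 3 * binom2 s + 3 * s) = q\<^sup>2 * q powi (3 * binom2 s) * q powi (5 * s)"
      using q(2) by (simp only: power_int_add power_int_numeral simp_thms)
    moreover have "hecke_term q x (1, s) = (-1) powi (1 + s) * x powi (-1) * q powi (2 + 2 * s + 3 * binom2 s + 3 * s)"
      by (simp add: hecke_term_def)
    ultimately show ?thesis by (simp add: p3 power_int_add[of "-1 :: complex"] power_int_minus field_simps)
  qed
  ultimately show "((\<lambda>s. hecke_term q x (1, s)) has_sum (qpoch_inf q q / x)) UNIV"
    by (simp only:)
  have "((\<lambda>s. q ^ 5 / x\<^sup>2 * ((-1) powi s * (q ^ 3) powi binom2 s * (q ^ 7) powi s))
           has_sum (q ^ 5 / x\<^sup>2 * Theta (q ^ 7) (q ^ 3))) UNIV"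
    using q by (intro has_sum_cmult_right J3) auto
  moreover have "q ^ 5 / x\<^sup>2 * Theta (q ^ 7) (q ^ 3) = qpoch_inf q q / x\<^sup>2"
  proof -
    have "Theta (q ^ (1 + 3)) (q ^ 3) = - qpoch_inf q q / q"
      using T3[of 1] Theta_cubed_base(1)[OF q] by (simp only: power_one_right)
    hence "Theta (q ^ 4) (q ^ 3) = - qpoch_inf q q / q"
      by (simp only: one_plus_numeral semiring_norm)
    moreover have "Theta (q ^ 7) (q ^ 3) = - Theta (q ^ 4) (q ^ 3) / q ^ 4"
      using T3[of 4] by (simp only: numeral_plus_numeral semiring_norm)
    ultimately have "Theta (q ^ 7) (q ^ 3) = qpoch_inf q q / q ^ 5"
      using q(2) by (simp only:) (simp add: eval_nat_numeral)
    thus ?thesis using q(2) by (simp only:) (simp add: field_simps)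
  qed
  moreover have "q ^ 5 / x\<^sup>2 * ((-1) powi s * (q ^ 3) powi binom2 s * (q ^ 7) powi s) = hecke_term q x (2, s)" for s
  proof -
    have "1 + 4 + 4 * s + 3 * binom2 s + 3 * s = 5 + 3 * binom2 s + 7 * s" by simp
    hence "q powi (1 + 4 + 4 * s + 3 * binom2 s + 3 * s) = q ^ 5 * q powi (3 * binom2 s) * q powi (7 * s)"
      using q(2) by (simp only: power_int_add power_int_numeral simp_thms)
    moreover have "hecke_term q x (2, s) = (-1) powi (2 + s) * x powi (-2) * q powi (1 + 4 + 4 * s + 3 * binom2 s + 3 * s)"
      by (simp add: hecke_term_def e)
    ultimately show ?thesis by (simp add: p3 power_int_add[of "-1 :: complex"] power_int_minus field_simps)
  qed
  ultimately show "((\<lambda>s. hecke_term q x (2, s)) has_sum (qpoch_inf q q / x ^ 2)) UNIV"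
    by (simp only:)
  note inv = Theta_inverse[OF q x]
  have "((\<lambda>r. - ((-1) powi r * q powi binom2 r * (1 / x) powi r)) has_sum (Theta x q / x)) UNIV"
    using has_sum_cmult_right[OF jacobi_triple_product_has_sum[OF q, of "1/x"], of "-1"] x inv by simp
  thus "((\<lambda>r. hecke_term q x (r, -1)) has_sum (Theta x q / x)) UNIV"
    using x by (simp add: hecke_term_def e power_int_diff power_int_minus power_int_divide_distrib field_simps)
  have sh: "Theta (1 / (q\<^sup>2 * x)) q = - Theta x q / (q ^ 3 * x ^ 3)"
    using Theta_mult_q_powi[OF q, of "1/x" "-2"] inv q x e
    by (simp add: power_int_minus field_simps eval_nat_numeral)
  have "((\<lambda>r. q ^ 3 * ((-1) powi r * q powi binom2 r * (1 / (q\<^sup>2 * x)) powi r))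
          has_sum (q ^ 3 * (- Theta x q / (q ^ 3 * x ^ 3)))) UNIV"
    unfolding sh[symmetric] using q x by (intro has_sum_cmult_right jacobi_triple_product_has_sum) auto
  moreover have "q ^ 3 * ((-1) powi r * q powi binom2 r * (1 / (q\<^sup>2 * x)) powi r) = hecke_term q x (r, -2)" for r
  proof -
    have "hecke_term q x (r, -2) = (-1) powi (r - 2) * x powi (- r) * q powi (3 + binom2 r - 2 * r)"
      by (simp add: hecke_term_def e algebra_simps)
    also have "q powi (3 + binom2 r - 2 * r) = q ^ 3 * q powi binom2 r / (q\<^sup>2) powi r"
      using q by (simp add: power_int_diff power_int_add p3)
    finally show ?thesis
      by (simp add: power_int_diff power_int_minus power_int_divide_distrib power_int_mult_distrib field_simps)
  qed
  ultimately show "((\<lambda>r. hecke_term q x (r, -2)) has_sum (- Theta x q / x ^ 3)) UNIV"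
    using q by simp
qed

text \<open>Reindexing the sum at \<open>q * x\<close> by \<open>(r, s) \<mapsto> (r - 3, s + 2)\<close> gives \<open>- (x ^ 3)\<close> times the sum at
  \<open>x\<close>, except for the five strips on which \<open>sg2\<close> changes.\<close>

lemma hecke123_shift:
  assumes q: "norm q < 1" "q \<noteq> 0" and x: "x \<noteq> 0"
  shows "hecke123 q (q * x) = - (x ^ 3) * hecke123 q x + (x + x\<^sup>2) * qpoch_inf q q + (1 - x\<^sup>2) * Theta x q"
proof -
  define t where "t = hecke_term q x"
  have "((\<lambda>(r, s). sg2 r s * t (r, s)) has_sum hecke123 q x) UNIV"
    using hecke_summable[OF q x] unfolding t_def hecke123_def by (rule has_sum_infsum)
  from has_sum_add[OF has_sum_add[OF has_sum_diff[OF has_sum_diff[OF has_sum_diff[OF this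
      has_sum_row[OF hecke_term_strip_sums(1)[OF q x], of 0]]
      has_sum_row[OF hecke_term_strip_sums(2)[OF q x], of 1]] has_sum_row[OF hecke_term_strip_sums(3)[OF q x], of 2]]
      has_sum_column[OF hecke_term_strip_sums(4)[OF q x], of "-1"]] has_sum_column[OF hecke_term_strip_sums(5)[OF q x], of "-2"]]
  have "((\<lambda>(r, s). sg2 (r - 3) (s + 2) * t (r, s)) has_sum
          (hecke123 q x - 0 - qpoch_inf q q / x - qpoch_inf q q / x ^ 2 + Theta x q / x + (- Theta x q / x ^ 3))) UNIV"
    by (rule has_sum_cong[THEN iffD1, rotated]) (auto simp: sg2_shift t_def algebra_simps)
  from has_sum_cmult_right[OF this, of "- (x ^ 3)"]
  have "((\<lambda>p. - (x ^ 3) * (case p of (r, s) \<Rightarrow> sg2 (r - 3) (s + 2) * t (r, s))) has_sum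
          (- (x ^ 3) * (hecke123 q x - 0 - qpoch_inf q q / x - qpoch_inf q q / x ^ 2 + Theta x q / x + (- Theta x q / x ^ 3)))) UNIV" .
  moreover have "(\<lambda>p. - (x ^ 3) * (case p of (r, s) \<Rightarrow> sg2 (r - 3) (s + 2) * t (r, s))) =
      (\<lambda>(r, s). sg2 (r - 3) (s + 2) * hecke_term q (q * x) (r - 3, s + 2))"
    using hecke_term_shift[OF q(2) x] by (auto simp: t_def fun_eq_iff)
  ultimately have A: "((\<lambda>(r, s). sg2 (r - 3) (s + 2) * hecke_term q (q * x) (r - 3, s + 2)) has_sum
          (- (x ^ 3) * (hecke123 q x - 0 - qpoch_inf q q / x - qpoch_inf q q / x ^ 2 + Theta x q / x + (- Theta x q / x ^ 3)))) UNIV"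
    by (simp only:)
  have B: "(\<Sum>\<^sub>\<infinity>(r, s). sg2 (r - 3) (s + 2) * hecke_term q (q * x) (r - 3, s + 2)) = hecke123 q (q * x)"
    unfolding hecke123_def
    by (rule infsum_reindex_bij_witness[of _ "\<lambda>(r, s). (r + 3, s - 2)" "\<lambda>(r, s). (r - 3, s + 2)"]) auto
  have "hecke123 q (q * x) = - (x ^ 3) * (hecke123 q x - 0 - qpoch_inf q q / x - qpoch_inf q q / x ^ 2 + Theta x q / x + (- Theta x q / x ^ 3))"
    using infsumI[OF A] unfolding B .
  also have "\<dots> = - (x ^ 3) * hecke123 q x + (x + x\<^sup>2) * qpoch_inf q q + (1 - x\<^sup>2) * Theta x q"
    using x by (simp add: field_simps eval_nat_numeral)
  finally show ?thesis .
qed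

section \<open>Appell functions as Lambert-type series\<close>

text \<open>The series in an Appell function, with its denominators in the form \<open>1 + c * p powi r\<close>. In the
  arguments \<open>c\<close> and \<open>y\<close> it separates the dependence on the poles from the dependence on the Laurent
  variable; the three Appell functions of the main identity each depend on \<open>x\<close> through only one of
  them.\<close>

definition lambert :: "complex \<Rightarrow> complex \<Rightarrow> complex \<Rightarrow> complex" where
  "lambert p c y = (\<Sum>\<^sub>\<infinity>r. p powi binom2 r * y powi r / (1 + c * p powi r))"

lemma appell_m_eq_lambert:
  assumes "p \<noteq> 0"
  shows "appell_m x z p = lambert p (- (x * z / p)) (- z) / Theta z p"
proof -
  have "(-1) powi r * p powi binom2 r * z powi r / (1 - p powi (r - 1) * x * z)
      = p powi binom2 r * (- z) powi r / (1 + (- (x * z / p)) * p powi r)" for r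
  proof -
    have "(- z) powi r = (-1) powi r * z powi r"
      by (simp flip: power_int_mult_distrib)
    moreover have "p powi (r - 1) * x * z = (x * z / p) * p powi r"
      using assms by (simp add: power_int_diff)
    ultimately show ?thesis by simp
  qed
  thus ?thesis by (simp add: appell_m_def lambert_def)
qed

text \<open>For large \<open>r\<close> the term \<open>c * p powi r\<close> is small and for very negative \<open>r\<close> it is large, uniformly for
  \<open>c\<close> in an annulus. So only finitely many denominators can be small.\<close>

lemma lambert_denominators:
  fixes p :: complex
  assumes p: "norm p < 1" "p \<noteq> 0" and a: "a > 0"
  obtains J :: "int set" where "finite J"
    and "\<And>r c. r \<notin> J \<Longrightarrow> a \<le> norm c \<Longrightarrow> norm c \<le> b \<Longrightarrow> 1 / 2 \<le> norm (1 + c * p powi r)"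
proof -
  define \<rho> where "\<rho> = norm p"
  have \<rho>: "0 < \<rho>" "\<rho> < 1" using p by (auto simp: \<rho>_def)
  have "(\<lambda>n. b * \<rho> ^ n) \<longlonglongrightarrow> b * 0" "(\<lambda>n. \<rho> ^ n) \<longlonglongrightarrow> 0"
    using \<rho> by (intro tendsto_intros LIMSEQ_power_zero; simp)+
  from order_tendstoD(2)[OF this(1), of "1/2"] order_tendstoD(2)[OF this(2), of "2 * a / 3"]
  have "eventually (\<lambda>n. b * \<rho> ^ n < 1 / 2) sequentially" "eventually (\<lambda>n. \<rho> ^ n < 2 * a / 3) sequentially"
    using a by simp_all
  hence "eventually (\<lambda>n. b * \<rho> ^ n < 1 / 2 \<and> \<rho> ^ n < 2 * a / 3) sequentially"
    by eventually_elim auto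
  then obtain N where N: "\<And>n. n \<ge> N \<Longrightarrow> b * \<rho> ^ n < 1 / 2" "\<And>n. n \<ge> N \<Longrightarrow> \<rho> ^ n < 2 * a / 3"
    unfolding eventually_sequentially by blast
  show ?thesis
  proof
    show "finite {-int N..int N}" by simp
    fix r :: int and c :: complex
    assume r: "r \<notin> {-int N..int N}" and c: "a \<le> norm c" "norm c \<le> b"
    define n where "n = nat \<bar>r\<bar>"
    have n: "n \<ge> N" using r by (auto simp: n_def)
    show "1 / 2 \<le> norm (1 + c * p powi r)"
    proof (cases "r \<ge> 0")
      case True
      hence "norm (c * p powi r) = norm c * \<rho> ^ n"
        by (simp add: n_def norm_mult norm_power norm_power_int \<rho>_def power_int_def)
      also have "\<dots> \<le> b * \<rho> ^ n" using c \<rho> by (intro mult_right_mono) auto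
      finally have "norm (c * p powi r) < 1 / 2" using N(1)[OF n] by linarith
      thus ?thesis using norm_triangle_ineq2[of 1 "- (c * p powi r)"] by simp
    next
      case False
      hence "norm (c * p powi r) = norm c / \<rho> ^ n"
        by (simp add: n_def norm_mult norm_power norm_inverse power_inverse norm_power_int \<rho>_def power_int_def divide_inverse)
      moreover have "a / \<rho> ^ n \<le> norm c / \<rho> ^ n" using c \<rho> by (intro divide_right_mono) auto
      moreover have "3 / 2 < a / \<rho> ^ n" using N(2)[OF n] \<rho> by (simp add: field_simps)
      ultimately have "3 / 2 < norm (c * p powi r)" by linarith
      thus ?thesis using norm_triangle_ineq2[of "c * p powi r" "-1"] by (simp add: add.commute)
    qed
  qed
qed

lemma lambert_denominators_bounded:
  fixes p c :: complex
  assumes "norm p < 1" "p \<noteq> 0" and "c \<noteq> 0"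
  obtains C where "\<And>r. norm (1 / (1 + c * p powi r)) \<le> C"
proof -
  obtain J where J: "finite J" "\<And>r. r \<notin> J \<Longrightarrow> 1 / 2 \<le> norm (1 + c * p powi r)"
    using lambert_denominators[OF assms(1,2), of "norm c" "norm c"] assms(3)
    by (metis order_refl zero_less_norm_iff)
  have "norm (1 / (1 + c * p powi r)) \<le> 2 + (\<Sum>r\<in>J. norm (1 / (1 + c * p powi r)))" for r
  proof (cases "r \<in> J")
    case True
    hence "norm (1 / (1 + c * p powi r)) \<le> (\<Sum>r\<in>J. norm (1 / (1 + c * p powi r)))"
      using J(1) by (intro member_le_sum) auto
    thus ?thesis by simp
  next
    case False
    have "0 < norm (1 + c * p powi r)" using J(2)[OF False] by linarith
    hence "norm (1 / (1 + c * p powi r)) \<le> 1 / (1 / 2)"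
      unfolding norm_divide norm_one using J(2)[OF False] by (intro divide_left_mono mult_pos_pos) auto
    moreover have "0 \<le> (\<Sum>r\<in>J. norm (1 / (1 + c * p powi r)))" by (intro sum_nonneg) simp
    ultimately show ?thesis by simp
  qed
  thus ?thesis using that by blast
qed

lemma lambert_summable:
  fixes p c y :: complex
  assumes "norm p < 1" "p \<noteq> 0" "c \<noteq> 0" "y \<noteq> 0"
  shows "(\<lambda>r. p powi binom2 r * y powi r / (1 + c * p powi r)) summable_on A"
proof -
  obtain C where C: "\<And>r. norm (1 / (1 + c * p powi r)) \<le> C"
    using lambert_denominators_bounded[OF assms(1-3)] by blast
  have "(\<lambda>r. 1 / (1 + c * p powi r) * p powi binom2 r * y powi r) summable_on UNIV"
    by (rule summable_on_theta[OF assms(1,2,4) C])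
  hence "(\<lambda>r. p powi binom2 r * y powi r / (1 + c * p powi r)) summable_on UNIV"
    by (simp add: field_simps)
  thus ?thesis by (rule summable_on_subset) simp
qed

text \<open>The factor \<open>p powi r\<close> from the argument is written as
  \<open>((1 + c * p powi r) - 1) / c\<close>; the first part cancels the denominator and leaves a theta series.\<close>

lemma lambert_mult_base:
  assumes p: "norm p < 1" "p \<noteq> 0" and "c \<noteq> 0" "y \<noteq> 0" and nz: "\<And>r. 1 + c * p powi r \<noteq> 0"
  shows "lambert p c (p * y) = (Theta (- y) p - lambert p c y) / c"
proof -
  have "((\<lambda>r. (-1) powi r * p powi binom2 r * (- y) powi r) has_sum Theta (- y) p) UNIV"
    using assms by (intro jacobi_triple_product_has_sum) auto
  moreover have "((\<lambda>r. p powi binom2 r * y powi r / (1 + c * p powi r)) has_sum lambert p c y) UNIV"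
    unfolding lambert_def using assms by (intro has_sum_infsum lambert_summable) auto
  ultimately have "((\<lambda>r. 1 / c * ((-1) powi r * p powi binom2 r * (- y) powi r
       - p powi binom2 r * y powi r / (1 + c * p powi r))) has_sum (1 / c * (Theta (- y) p - lambert p c y))) UNIV"
    by (intro has_sum_cmult_right has_sum_diff)
  moreover have "1 / c * ((-1) powi r * p powi binom2 r * (- y) powi r
       - p powi binom2 r * y powi r / (1 + c * p powi r)) = p powi binom2 r * (p * y) powi r / (1 + c * p powi r)" for r
  proof -
    have y: "(-1) powi r * p powi binom2 r * (- y) powi r = p powi binom2 r * y powi r"
      by (simp add: mult.left_commute flip: power_int_mult_distrib)
    show ?thesis
      unfolding y power_int_mult_distrib using nz[of r] assms(3) by (simp add: divide_simps) (simp add: algebra_simps)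
  qed
  ultimately have "((\<lambda>r. p powi binom2 r * (p * y) powi r / (1 + c * p powi r)) has_sum (1 / c * (Theta (- y) p - lambert p c y))) UNIV"
    by (simp only:)
  thus ?thesis by (simp add: lambert_def infsumI)
qed

lemma lambert_div_base:
  assumes "p \<noteq> 0" "y \<noteq> 0"
  shows "lambert p (c / p) y = y * lambert p c (p * y)"
proof -
  have "lambert p (c / p) y = (\<Sum>\<^sub>\<infinity>r. y * (p powi binom2 r * (p * y) powi r / (1 + c * p powi r)))"
    unfolding lambert_def
  proof (rule infsum_reindex_bij_witness[of _ "\<lambda>r. r + 1" "\<lambda>r. r - 1"])
    fix r :: int
    define k where "k = r - 1"
    have r: "r = k + 1" by (simp add: k_def)
    show "y * (p powi binom2 (r - 1) * (p * y) powi (r - 1) / (1 + c * p powi (r - 1))) =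
          p powi binom2 r * y powi r / (1 + c / p * p powi r)"
      unfolding r binom2_plus1 using assms by (simp add: power_int_add power_int_mult_distrib mult_ac)
  qed auto
  also have "\<dots> = y * lambert p c (p * y)"
    unfolding lambert_def by (rule infsum_cmult_right')
  finally show ?thesis .
qed

lemma lambert_holomorphic:
  assumes p: "norm p < 1" "p \<noteq> 0" and c: "c \<noteq> 0"
  shows "lambert p c holomorphic_on -{0}"
  unfolding lambert_def[abs_def]
proof (rule holomorphic_on_infsum)
  fix r show "(\<lambda>y. p powi binom2 r * y powi r / (1 + c * p powi r)) holomorphic_on -{0}"
    by (cases "1 + c * p powi r = 0") (auto intro!: holomorphic_intros)
next
  fix y :: complex assume "y \<in> -{0}"
  hence y: "norm y / 2 > 0" by simp
  obtain C where C: "\<And>r. norm (1 / (1 + c * p powi r)) \<le> C"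
    using lambert_denominators_bounded[OF assms] by blast
  define M where "M r = C * (norm p powi binom2 r * (norm y / 2) powi r + norm p powi binom2 r * (2 * norm y) powi r)" for r
  have "M summable_on UNIV"
    unfolding M_def using p y by (intro summable_on_cmult_right summable_on_add summable_on_theta_real) auto
  moreover have "cball y (norm y / 2) \<subseteq> -{0}"
    using y ball_half_norm(1)[of 0 y] by auto
  moreover have "norm (p powi binom2 r * z powi r / (1 + c * p powi r)) \<le> M r"
    if z: "z \<in> cball y (norm y / 2)" for r z
  proof -
    have "norm z powi r \<le> (norm y / 2) powi r + (2 * norm y) powi r"
      using y ball_half_norm[OF z] by (rule power_int_le_add_endpoints)
    hence le: "norm p powi binom2 r * norm z powi r \<le> norm p powi binom2 r * ((norm y / 2) powi r + (2 * norm y) powi r)"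
      by (intro mult_left_mono) auto
    have "norm (1 / (1 + c * p powi r)) * (norm p powi binom2 r * norm z powi r)
        \<le> C * (norm p powi binom2 r * ((norm y / 2) powi r + (2 * norm y) powi r))"
      by (rule mult_mono[OF C le order_trans[OF norm_ge_zero C]]) simp
    thus ?thesis by (simp add: M_def norm_mult norm_divide norm_power_int algebra_simps)
  qed
  ultimately show "\<exists>d>0. \<exists>M. cball y d \<subseteq> -{0} \<and> M summable_on UNIV \<and>
      (\<forall>r\<in>UNIV. \<forall>z\<in>cball y d. norm (p powi binom2 r * z powi r / (1 + c * p powi r)) \<le> M r)"
    using y by blast
qed auto

lemma lambert_analytic [analytic_intros]:
  assumes "norm p < 1" "p \<noteq> 0" "c \<noteq> 0" "f analytic_on A" "\<And>x. x \<in> A \<Longrightarrow> f x \<noteq> 0"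
  shows "(\<lambda>x. lambert p c (f x)) analytic_on A"
proof -
  have "lambert p c analytic_on -{0}"
    using lambert_holomorphic[OF assms(1-3)] by (subst analytic_on_open) auto
  from analytic_on_compose_gen[OF assms(4) this] show ?thesis
    using assms(5) by (simp add: o_def)
qed

text \<open>Near \<open>c\<close> the series is the finite sum of its terms that are singular at \<open>c\<close> and an analytic
  function. Since \<open>1 / 0 = 0\<close>, the formula holds also at \<open>z = c\<close>.\<close>

lemma lambert_near:
  assumes p: "norm p < 1" "p \<noteq> 0" and c: "c \<noteq> 0" and y: "y \<noteq> 0"
  obtains g where "g analytic_on {c}"
    and "eventually (\<lambda>z. lambert p z y =
           (\<Sum>r | 1 + c * p powi r = 0. p powi binom2 r * y powi r / (1 + z * p powi r)) + g z) (nhds c)"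
proof -
  define t where "t z r = p powi binom2 r * y powi r / (1 + z * p powi r)" for z r
  define B where "B = ball c (norm c / 2)"
  have c2: "norm c / 2 > 0" using c by simp
  have B: "open B" "c \<in> B" using c by (auto simp: B_def)
  obtain J where J: "finite J" and J': "\<And>r z. r \<notin> J \<Longrightarrow> norm c / 2 \<le> norm z \<Longrightarrow> norm z \<le> 2 * norm c \<Longrightarrow> 1 / 2 \<le> norm (1 + z * p powi r)"
    using lambert_denominators[OF p c2, of "2 * norm c"] by blast
  have J2: "1 / 2 \<le> norm (1 + z * p powi r)" if "z \<in> B" "r \<notin> J" for r z
    using that ball_half_norm[of z c] by (intro J') (auto simp: B_def)
  \<comment> \<open>indices of the terms with a pole at \<open>c\<close>; they are kept apart from the other terms of index in \<open>J\<close>\<close>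
  define Z where "Z = {r. 1 + c * p powi r = 0}"
  have ZJ: "Z \<subseteq> J" using J2[OF B(2)] by (force simp: Z_def)
  define g where "g z = (\<Sum>r\<in>J - Z. t z r) + (\<Sum>\<^sub>\<infinity>r\<in>-J. t z r)" for z
  have "(\<lambda>z. \<Sum>\<^sub>\<infinity>r\<in>-J. t z r) holomorphic_on B"
  proof (rule holomorphic_on_infsum)
    fix r assume r: "r \<in> -J"
    have "1 + z * p powi r \<noteq> 0" if "z \<in> B" for z
      using J2[OF that, of r] r by auto
    thus "(\<lambda>z. t z r) holomorphic_on B"
      unfolding t_def by (intro holomorphic_intros) auto
  next
    fix z assume "z \<in> B"
    then obtain d where d: "d > 0" "cball z d \<subseteq> B"
      using B(1) open_contains_cball by blast
    have "(\<lambda>r. 2 * (norm p powi binom2 r * norm y powi r)) summable_on UNIV"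
      using p y by (intro summable_on_cmult_right summable_on_theta_real) auto
    hence "(\<lambda>r. 2 * (norm p powi binom2 r * norm y powi r)) summable_on -J"
      by (rule summable_on_subset) simp
    moreover have "norm (t u r) \<le> 2 * (norm p powi binom2 r * norm y powi r)" if "r \<in> -J" "u \<in> cball z d" for r u
    proof -
      have *: "1 / 2 \<le> norm (1 + u * p powi r)" using J2[of u r] that d by auto
      moreover from this have "0 < norm (1 + u * p powi r)" by linarith
      ultimately have "norm (t u r) \<le> (norm p powi binom2 r * norm y powi r) / (1 / 2)"
        unfolding t_def norm_divide norm_mult norm_power_int
        by (intro divide_left_mono mult_pos_pos) auto
      thus ?thesis by simp
    qed
    ultimately show "\<exists>d>0. \<exists>M. cball z d \<subseteq> B \<and> M summable_on -J \<and> (\<forall>r\<in>-J. \<forall>u\<in>cball z d. norm (t u r) \<le> M r)"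
      using d by blast
  qed (rule B(1))
  hence "(\<lambda>z. \<Sum>\<^sub>\<infinity>r\<in>-J. t z r) analytic_on {c}"
    using B analytic_at by blast
  moreover have "(\<lambda>z. \<Sum>r\<in>J - Z. t z r) analytic_on {c}"
    unfolding t_def by (intro analytic_intros) (auto simp: Z_def)
  ultimately have "g analytic_on {c}"
    unfolding g_def[abs_def] by (rule analytic_on_add[rotated])
  moreover have "eventually (\<lambda>z. lambert p z y = (\<Sum>r\<in>Z. t z r) + g z) (nhds c)"
    using eventually_nhds_in_open[OF B]
  proof eventually_elim
    case (elim z)
    have "norm c / 2 \<le> norm z" using elim ball_half_norm[of z c] by (auto simp: B_def)
    hence z: "z \<noteq> 0" using c2 by auto
    have "lambert p z y = (\<Sum>\<^sub>\<infinity>r\<in>J \<union> -J. t z r)"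
      by (simp add: lambert_def t_def)
    also have "\<dots> = (\<Sum>\<^sub>\<infinity>r\<in>J. t z r) + (\<Sum>\<^sub>\<infinity>r\<in>-J. t z r)"
      unfolding t_def by (intro infsum_Un_disjoint lambert_summable p z y) auto
    also have "(\<Sum>\<^sub>\<infinity>r\<in>J. t z r) = (\<Sum>r\<in>J. t z r)" using J by simp
    also have "\<dots> = (\<Sum>r\<in>Z. t z r) + (\<Sum>r\<in>J - Z. t z r)"
      using sum.subset_diff[OF ZJ J, of "t z"] by (simp add: add.commute)
    finally show ?case by (simp add: g_def add.assoc)
  qed
  ultimately show ?thesis using that unfolding Z_def t_def by blast
qed

text \<open>These are the denominators \<open>1 + q powi (3 * r - 1)\<close> and \<open>1 + q powi (3 * r - 2)\<close>. The exponents are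
  nonzero, so the powers do not have modulus \<open>1\<close>.\<close>

lemma appell_cube_denominators_nonzero:
  fixes q :: complex
  assumes "norm q < 1" "q \<noteq> 0"
  shows "1 + 1 / q * (q ^ 3) powi r \<noteq> 0" "1 + 1 / q ^ 2 * (q ^ 3) powi r \<noteq> 0"
proof -
  have q3: "(q ^ 3) powi r = q powi (3 * r)" by (simp add: power_int_mult)
  have *: "1 + q powi n \<noteq> 0" if "n \<noteq> 0" for n
    using norm_q_powi_ne_1[OF assms that] by (metis add_eq_0_iff norm_minus_cancel norm_one)
  have "1 / q * (q ^ 3) powi r = q powi (3 * r - 1)" "1 / q ^ 2 * (q ^ 3) powi r = q powi (3 * r - 2)"
    unfolding q3 using assms by (simp_all add: power_int_diff)
  moreover have "3 * r - 1 \<noteq> 0" "3 * r - 2 \<noteq> 0" by presburger+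
  ultimately show "1 + 1 / q * (q ^ 3) powi r \<noteq> 0" "1 + 1 / q ^ 2 * (q ^ 3) powi r \<noteq> 0"
    using *[of "3 * r - 1"] *[of "3 * r - 2"] by simp_all
qed

lemma Theta_eq_0_iff_lambert_pole:
  assumes q: "norm q < 1" "q \<noteq> 0" and w: "w \<noteq> 0"
  shows "Theta (- w) q = 0 \<longleftrightarrow> (\<exists>r::int. 1 + w * q powi r = 0)"
proof -
  have "- w = q powi n \<longleftrightarrow> 1 + w * q powi (- n) = 0" for n
  proof -
    have "1 + w * q powi (- n) = (q powi n + w) / q powi n"
      using q by (simp add: power_int_minus field_simps)
    hence "1 + w * q powi (- n) = 0 \<longleftrightarrow> q powi n = - w"
      using q by (simp add: eq_neg_iff_add_eq_0)
    thus ?thesis by auto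
  qed
  moreover have "Theta (- w) q = 0 \<longleftrightarrow> (\<exists>n::int. - w = q powi n)"
    using Theta_eq_0_iff[OF q, of "- w"] w by simp
  ultimately have "Theta (- w) q = 0 \<longleftrightarrow> (\<exists>n::int. 1 + w * q powi (- n) = 0)"
    by simp
  also have "\<dots> \<longleftrightarrow> (\<exists>r::int. 1 + w * q powi r = 0)"
    by (metis minus_minus)
  finally show ?thesis .
qed

section \<open>Holomorphic functions on the punctured plane\<close>

lemma eventually_nhds_compose_analytic:
  assumes "f analytic_on {x0}" and "eventually P (nhds (f x0))"
  shows "eventually (\<lambda>x. P (f x)) (nhds x0)"
proof -
  have "isCont f x0" using assms(1) by (rule analytic_at_imp_isCont)
  hence "filterlim f (nhds (f x0)) (nhds x0)"
    using isCont_def tendsto_at_iff_tendsto_nhds by blast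
  thus ?thesis using assms(2) by (simp add: filterlim_iff)
qed

lemma divide_out_zero:
  fixes f :: "complex \<Rightarrow> complex"
  assumes "f analytic_on {a}" "f a = 0"
  obtains g where "g analytic_on {a}" "\<And>x. x \<noteq> a \<Longrightarrow> f x = (x - a) * g x"
proof -
  define g where "g x = (if x = a then deriv f a else f x / (x - a))" for x
  have "g analytic_on {a}"
    by (rule pole_theorem_analytic_0[OF assms(1) _ _ assms(2)])
       (auto simp: g_def intro!: exI[of _ 1])
  thus ?thesis using that by (simp add: g_def)
qed

lemma powi_scale_into_annulus:
  fixes q y :: complex
  assumes q: "norm q < 1" "q \<noteq> 0" and y: "y \<noteq> 0"
  shows "\<exists>n::int. norm q \<le> norm (q powi n * y) \<and> norm (q powi n * y) \<le> 1"
proof -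
  define l where "l = ln (norm q)"
  have l: "l < 0" using q by (simp add: l_def)
  define n where "n = \<lceil>- ln (norm y) / l\<rceil>"
  have "of_int n \<ge> - ln (norm y) / l" "of_int n - 1 \<le> - ln (norm y) / l"
    unfolding n_def by linarith+
  hence n: "of_int n * l \<le> - ln (norm y)" "(of_int n - 1) * l \<ge> - ln (norm y)"
    using l by (simp_all add: field_simps)
  have ln: "ln (norm (q powi n * y)) = of_int n * l + ln (norm y)"
    using q y by (simp add: norm_mult norm_power_int ln_mult l_def ln_powr flip: powr_real_of_int')
  have pos: "norm (q powi n * y) > 0" using q y by simp
  have "ln (norm q) \<le> ln (norm (q powi n * y))" "ln (norm (q powi n * y)) \<le> ln 1"
    using n unfolding ln l_def[symmetric] by (simp_all add: algebra_simps)
  hence "norm q \<le> norm (q powi n * y)" "norm (q powi n * y) \<le> 1"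
    using pos q by (simp_all add: ln_le_cancel_iff del: ln_one)
  thus ?thesis by blast
qed

text \<open>Multiplication by powers of \<open>q\<close> moves every point into the annulus \<open>norm q \<le> norm x \<le> 1\<close>, so \<open>h\<close> is
  bounded. Liouville's theorem applies to the entire function \<open>h \<circ> exp\<close>, and \<open>exp\<close> maps onto the
  punctured plane.\<close>

lemma antiperiodic_holomorphic_zero:
  fixes h :: "complex \<Rightarrow> complex"
  assumes q: "norm q < 1" "q \<noteq> 0" and hol: "h holomorphic_on -{0}"
    and shift: "\<And>x. x \<noteq> 0 \<Longrightarrow> h (q * x) = - h x" and y: "y \<noteq> 0"
  shows "h y = 0"
proof -
  have step: "norm (h (q powi n * x)) = norm (h x)" if x: "x \<noteq> 0" for n :: int and x
  proof (induction n rule: int_induct[of _ 0])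
    case (step1 n)
    thus ?case using shift[of "q powi n * x"] x q by (simp add: power_int_add mult_ac)
  next
    case (step2 n)
    have eq: "q powi n * x = q * (q powi (n - 1) * x)" using q by (simp add: power_int_diff)
    have "norm (h (q powi n * x)) = norm (h (q powi (n - 1) * x))"
      by (subst eq, subst shift) (use x q in auto)
    thus ?case using step2 by simp
  qed simp
  define S where "S = cball (0::complex) 1 - ball 0 (norm q)"
  have "compact S" unfolding S_def by (intro compact_diff compact_cball open_ball)
  moreover have "S \<subseteq> -{0}" using q by (auto simp: S_def)
  hence "continuous_on S h"
    using hol by (meson continuous_on_subset holomorphic_on_imp_continuous_on)
  ultimately have "bounded (h ` S)"
    by (intro compact_imp_bounded compact_continuous_image)
  then obtain C where C: "\<And>x. x \<in> S \<Longrightarrow> norm (h x) \<le> C" by (auto simp: bounded_iff)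
  have bound: "norm (h x) \<le> C" if x: "x \<noteq> 0" for x
  proof -
    obtain n :: int where "norm q \<le> norm (q powi n * x)" "norm (q powi n * x) \<le> 1"
      using powi_scale_into_annulus[OF q x] by blast
    hence "q powi n * x \<in> S" by (auto simp: S_def)
    thus ?thesis using C step[OF x, of n] by metis
  qed
  have "(\<lambda>z. h (exp z)) holomorphic_on UNIV"
  proof -
    have "exp ` UNIV \<subseteq> -{0 :: complex}" by auto
    from holomorphic_on_compose_gen[OF holomorphic_on_exp hol this] show ?thesis
      by (simp add: o_def)
  qed
  moreover have "bounded (range (\<lambda>z. h (exp z)))"
    unfolding bounded_iff using bound by (intro exI[of _ C]) auto
  ultimately have "(\<lambda>z. h (exp z)) constant_on UNIV"
    by (rule Liouville_theorem)
  then obtain c where "\<And>z. h (exp z) = c" by (auto simp: constant_on_def)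
  hence c: "h x = c" if "x \<noteq> 0" for x using that by (metis exp_Ln)
  show ?thesis using shift[OF y] c[OF y] c[of "q * y"] q y by simp
qed

section \<open>Vanishing of the difference of the two sides\<close>

text \<open>The left side minus the right side of the main identity, multiplied by
  \<open>Theta (- (x ^ 3)) (q ^ 3)\<close>, with the Appell functions written as \<open>lambert\<close> series and the constant
  of the theta quotient as in \<open>theta_quotient_constant\<close>.\<close>

definition remainder_form :: "complex \<Rightarrow> complex \<Rightarrow> complex" where
  "remainder_form q x =
     Theta (- (x ^ 3)) (q ^ 3) * hecke123 q x
     - qpoch_inf q q / x * lambert (q ^ 3) (1 / q) (x ^ 3)
     - qpoch_inf q q / x ^ 2 * lambert (q ^ 3) (1 / q ^ 2) (x ^ 3)
     + Theta (- (x ^ 3)) (q ^ 3) * Theta x q / (x * Theta (-1) q) * lambert q (1 / x ^ 2) 1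
     + qpoch_inf q q ^ 3 / Theta (-1) q * Theta (- x) q * Theta (1 / x ^ 3) (q ^ 3) / Theta (- (1 / x ^ 2)) q"

lemma remainder_form_shift:
  assumes q: "norm q < 1" "q \<noteq> 0" and x: "x \<noteq> 0" and nz: "Theta (- (1 / x ^ 2)) q \<noteq> 0"
  shows "remainder_form q (q * x) = - remainder_form q x"
proof -
  have q3: "norm (q ^ 3) < 1" "q ^ 3 \<noteq> 0" using q by (auto intro: norm_power_lt_1)
  define w where "w = 1 / x ^ 2"
  have w: "w \<noteq> 0" "x ^ 2 = 1 / w" using x by (auto simp: w_def)
  have T1: "Theta (-1) q \<noteq> 0" by (rule Theta_minus_1_nonzero[OF q])
  have N: "Theta (- ((q * x) ^ 3)) (q ^ 3) = Theta (- (x ^ 3)) (q ^ 3) / x ^ 3"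
    using Theta_mult_q[OF q3, of "- (x ^ 3)"] x by (simp add: power_mult_distrib)
  have M1: "lambert (q ^ 3) (1 / q) ((q * x) ^ 3) = q * (Theta (- (x ^ 3)) (q ^ 3) - lambert (q ^ 3) (1 / q) (x ^ 3))"
    unfolding power_mult_distrib
    by (subst lambert_mult_base) (use q q3 x appell_cube_denominators_nonzero[OF q] in auto)
  have M2: "lambert (q ^ 3) (1 / q ^ 2) ((q * x) ^ 3) = q ^ 2 * (Theta (- (x ^ 3)) (q ^ 3) - lambert (q ^ 3) (1 / q ^ 2) (x ^ 3))"
    unfolding power_mult_distrib
    by (subst lambert_mult_base) (use q q3 x appell_cube_denominators_nonzero[OF q] in auto)
  have L1: "lambert q (v / q) 1 = (Theta (-1) q - lambert q v 1) / v"
    if "v \<noteq> 0" "\<And>r. 1 + v * q powi r \<noteq> 0" for v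
    using lambert_div_base[OF q(2), of 1 v] lambert_mult_base[OF q that(1), of 1] that(2) by simp
  have nzw: "1 + w * q powi r \<noteq> 0" for r
    using nz Theta_eq_0_iff_lambert_pole[OF q w(1)] by (auto simp: w_def)
  have nzw': "1 + w / q * q powi r \<noteq> 0" for r
    using nzw[of "r - 1"] q by (simp add: power_int_diff)
  have L: "lambert q (1 / (q * x) ^ 2) 1 = q * x ^ 2 * (Theta (-1) q - x ^ 2 * (Theta (-1) q - lambert q (1 / x ^ 2) 1))"
  proof -
    have "1 / (q * x) ^ 2 = w / q / q" by (simp add: w_def power_mult_distrib power2_eq_square)
    hence "lambert q (1 / (q * x) ^ 2) 1 = (Theta (-1) q - (Theta (-1) q - lambert q w 1) / w) / (w / q)"
      using L1[OF _ nzw'] L1[OF w(1) nzw] w q by simp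
    thus ?thesis unfolding w(2) w_def[symmetric] using w(1) q by simp
  qed
  have T: "Theta (q * x) q = - Theta x q / x" by (rule Theta_mult_q[OF q x])
  have Tm: "Theta (- (q * x)) q = Theta (- x) q / x" using Theta_mult_q[OF q, of "- x"] x by simp
  have Z: "Theta (1 / (q * x) ^ 3) (q ^ 3) = - Theta (1 / x ^ 3) (q ^ 3) / (q ^ 3 * x ^ 3)"
    using Theta_mult_q[OF q3, of "1 / (q * x) ^ 3"] q x by (simp add: power_mult_distrib field_simps)
  have S: "Theta (- (1 / (q * x) ^ 2)) q = Theta (- (1 / x ^ 2)) q / (q ^ 3 * x ^ 4)"
  proof -
    have "Theta (q powi (-2) * (- (1 / x ^ 2))) q = q powi (- binom2 (-2)) * (- (1 / x ^ 2)) ^ 2 * Theta (- (1 / x ^ 2)) q"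
      using Theta_mult_q_powi[OF q, of "- (1 / x ^ 2)" "-2"] x by simp
    moreover have "q powi (-2) * (- (1 / x ^ 2)) = - (1 / (q * x) ^ 2)"
      by (simp add: power_int_minus field_simps power_mult_distrib)
    moreover have "q powi (- binom2 (-2)) * (- (1 / x ^ 2)) ^ 2 = 1 / (q ^ 3 * x ^ 4)"
      by (simp add: binom2_def power_int_minus field_simps)
    ultimately show ?thesis by simp
  qed
  define N0 F P M10 M20 T0 L0 A Z0 S0 K where
    "N0 = Theta (- (x ^ 3)) (q ^ 3)" and "F = hecke123 q x" and "P = qpoch_inf q q"
    and "M10 = lambert (q ^ 3) (1 / q) (x ^ 3)" and "M20 = lambert (q ^ 3) (1 / q ^ 2) (x ^ 3)"
    and "T0 = Theta x q" and "L0 = lambert q (1 / x ^ 2) 1" and "A = Theta (- x) q"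
    and "Z0 = Theta (1 / x ^ 3) (q ^ 3)" and "S0 = Theta (- (1 / x ^ 2)) q" and "K = Theta (-1) q"
  have "remainder_form q (q * x) =
      N0 / x ^ 3 * (- (x ^ 3) * F + (x + x ^ 2) * P + (1 - x ^ 2) * T0)
      - P / (q * x) * (q * (N0 - M10)) - P / (q * x) ^ 2 * (q ^ 2 * (N0 - M20))
      + N0 / x ^ 3 * (- T0 / x) / (q * x * K) * (q * x ^ 2 * (K - x ^ 2 * (K - L0)))
      + P ^ 3 / K * (A / x) * (- Z0 / (q ^ 3 * x ^ 3)) / (S0 / (q ^ 3 * x ^ 4))"
    unfolding remainder_form_def N M1 M2 L T Tm Z S hecke123_shift[OF q x]
    by (simp only: N0_def F_def P_def M10_def M20_def T0_def L0_def A_def Z0_def S0_def K_def)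
  also have "\<dots> = - (N0 * F - P / x * M10 - P / x ^ 2 * M20 + N0 * T0 / (x * K) * L0 + P ^ 3 / K * A * Z0 / S0)"
  proof -
    have K: "K \<noteq> 0" "S0 \<noteq> 0" using T1 nz by (simp_all add: K_def S0_def)
    have 1: "P / (q * x) * (q * (N0 - M10)) = P / x * N0 - P / x * M10"
        "P / (q * x) ^ 2 * (q ^ 2 * (N0 - M20)) = P / x ^ 2 * N0 - P / x ^ 2 * M20"
      using q x by (simp_all add: field_simps)
    have 2: "N0 / x ^ 3 * (- (x ^ 3) * F + (x + x ^ 2) * P + (1 - x ^ 2) * T0) =
       - N0 * F + P / x ^ 2 * N0 + P / x * N0 + N0 * T0 / x ^ 3 - N0 * T0 / x"
      using x by (simp add: field_simps eval_nat_numeral)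
    have 3: "N0 / x ^ 3 * (- T0 / x) / (q * x * K) * (q * x ^ 2 * (K - x ^ 2 * (K - L0))) =
       - (N0 * T0 / x ^ 3) + N0 * T0 / x - N0 * T0 / (x * K) * L0"
      using q x K by (simp add: field_simps eval_nat_numeral)
    have 4: "P ^ 3 / K * (A / x) * (- Z0 / (q ^ 3 * x ^ 3)) / (S0 / (q ^ 3 * x ^ 4)) = - (P ^ 3 / K * A * Z0 / S0)"
      using q x K by (simp add: field_simps eval_nat_numeral)
    show ?thesis unfolding 1 2 3 4 by simp
  qed
  also have "\<dots> = - remainder_form q x"
    by (simp only: remainder_form_def N0_def F_def P_def M10_def M20_def T0_def L0_def A_def Z0_def S0_def K_def)
  finally show ?thesis .
qed

lemma remainder_form_analytic:
  assumes q: "norm q < 1" "q \<noteq> 0" and x: "x0 \<noteq> 0" and nz: "Theta (- (1 / x0 ^ 2)) q \<noteq> 0"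
  shows "remainder_form q analytic_on {x0}"
proof -
  have q3: "norm (q ^ 3) < 1" "q ^ 3 \<noteq> 0" using q by (auto intro: norm_power_lt_1)
  have x2: "1 / x0 ^ 2 \<noteq> 0" using x by simp
  obtain g where g: "g analytic_on {1 / x0 ^ 2}" and
    ev: "eventually (\<lambda>z. lambert q z 1 = (\<Sum>r | 1 + 1 / x0 ^ 2 * q powi r = 0.
            q powi binom2 r * 1 powi r / (1 + z * q powi r)) + g z) (nhds (1 / x0 ^ 2))"
    using lambert_near[OF q x2, of 1] by auto
  have "{r. 1 + 1 / x0 ^ 2 * q powi r = 0} = {}"
    using nz Theta_eq_0_iff_lambert_pole[OF q x2] by auto
  hence "eventually (\<lambda>z. lambert q z 1 = g z) (nhds (1 / x0 ^ 2))"
    using ev by simp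
  moreover have inv: "(\<lambda>x. 1 / x ^ 2) analytic_on {x0}"
    using x by (auto intro!: analytic_intros)
  ultimately have ev': "eventually (\<lambda>x. lambert q (1 / x ^ 2) 1 = g (1 / x ^ 2)) (nhds x0)"
    using eventually_nhds_compose_analytic[of "\<lambda>x. 1 / x ^ 2" x0 "\<lambda>z. lambert q z 1 = g z"] by blast
  have "(\<lambda>x. g (1 / x ^ 2)) analytic_on {x0}"
    using analytic_on_compose_gen[OF inv g] by (simp add: o_def)
  hence L: "(\<lambda>x. lambert q (1 / x ^ 2) 1) analytic_on {x0}"
    by (subst analytic_at_cong[OF ev' refl])
  have F: "hecke123 q analytic_on {x0}"
    using hecke123_holomorphic[OF q] x by (simp add: analytic_on_holomorphic) blast
  show ?thesis
    unfolding remainder_form_def[abs_def]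
    using q q3 x nz Theta_minus_1_nonzero[OF q] by (intro analytic_intros L F) auto
qed

text \<open>The first summand is the coefficient of the pole of the third Appell function, the second one that of
  the theta quotient. Since \<open>- x = q powi m / x\<close> and \<open>1 / x ^ 3 = (q ^ 3) powi (- m) * (- (x ^ 3))\<close>,
  quasi-periodicity makes both multiples of \<open>Theta (- (x ^ 3)) (q ^ 3) * Theta x q\<close>; the powers of
  \<open>q\<close> agree because \<open>x ^ 2 = - (q powi m)\<close> and \<open>2 * binom2 m = m * (m - 1)\<close>.\<close>

lemma residue_cancellation:
  assumes q: "norm q < 1" "q \<noteq> 0" and x: "x \<noteq> 0" and m: "x ^ 2 = - (q powi m)"
  shows "Theta (- (x ^ 3)) (q ^ 3) * Theta x q / (x * Theta (-1) q) * q powi binom2 m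
    + qpoch_inf q q ^ 3 / Theta (-1) q * Theta (- x) q * Theta (1 / x ^ 3) (q ^ 3)
       / (q powi binom2 m * (1 / x ^ 2) powi m * qpoch_inf q q ^ 3) = 0"
proof -
  have q3: "norm (q ^ 3) < 1" "q ^ 3 \<noteq> 0" using q by (auto intro: norm_power_lt_1)
  define N T K P b e where "N = Theta (- (x ^ 3)) (q ^ 3)" and "T = Theta x q"
    and "K = Theta (-1) q" and "P = qpoch_inf q q" and "b = binom2 m" and "e = (-1 :: complex) powi m"
  have nz: "K \<noteq> 0" "P \<noteq> 0"
    using Theta_minus_1_nonzero[OF q] qpoch_inf_self_nonzero[OF q(1)] by (simp_all add: K_def P_def)
  have e: "e * e = 1" "e \<noteq> 0"
    by (simp_all add: e_def flip: power_int_mult_distrib)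
  have qm: "q powi m = - (x ^ 2)" using m by simp
  have "Theta (1 / x) q = - T / x"
    using Theta_inverse[OF q x] by (simp add: T_def)
  moreover have "- x = q powi m * (1 / x)"
    unfolding qm using x by (simp add: power2_eq_square)
  ultimately have A: "Theta (- x) q = e * q powi (- b) * x powi m * (- T / x)"
    using Theta_mult_q_powi[OF q, of "1 / x" m] x
    by (simp add: e_def b_def power_int_minus power_int_divide_distrib)
  have B: "Theta (1 / x ^ 3) (q ^ 3) = q powi (- 3 * b - 3 * m) * x powi (3 * m) * N"
  proof -
    have "(q ^ 3) powi (- m) = 1 / (q powi m) ^ 3"
      by (simp add: power_int_minus power_int_power' power_int_power divide_inverse mult.commute)
    hence "1 / x ^ 3 = (q ^ 3) powi (- m) * (- (x ^ 3))"
      unfolding qm using x by (simp add: field_simps eval_nat_numeral)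
    hence "Theta (1 / x ^ 3) (q ^ 3) = (-1) powi (- m) * (q ^ 3) powi (- binom2 (- m)) * (- (x ^ 3)) powi m * N"
      using Theta_mult_q_powi[OF q3, of "- (x ^ 3)" "- m"] x by (simp add: N_def)
    moreover have "(- (x ^ 3)) powi m = e * (x ^ 3) powi m"
      by (simp add: e_def flip: power_int_mult_distrib)
    moreover have "(-1) powi (- m) = e" by (simp add: e_def power_int_minus_one_minus)
    moreover have "(q ^ 3) powi (- binom2 (- m)) = q powi (- 3 * b - 3 * m)"
    proof -
      have "- 3 * b - 3 * m = 3 * (- binom2 (- m))" by (simp add: b_def binom2_uminus)
      thus ?thesis using power_int_mult[of q 3 "- binom2 (- m)"] by (simp only: power_int_numeral)
    qed
    moreover have "(x ^ 3) powi m = x powi (3 * m)"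
      using power_int_mult[of x 3 m] by simp
    ultimately have "Theta (1 / x ^ 3) (q ^ 3) = (e * e) * (q powi (- 3 * b - 3 * m) * x powi (3 * m) * N)"
      by (simp only: mult_ac)
    thus ?thesis by (simp only: e(1) mult_1)
  qed
  \<comment> \<open>\<open>x ^ (6 * m)\<close> expressed by \<open>x ^ 2 = - (q powi m)\<close>\<close>
  have x6: "x powi m * x powi (3 * m) * x powi (2 * m) = e * q powi (3 * (m * m))"
  proof -
    have "x powi m * x powi (3 * m) * x powi (2 * m) = x powi (2 * (3 * m))"
      using x by (simp flip: power_int_add)
    also have "\<dots> = (- (q powi m)) powi (3 * m)"
      using m power_int_mult[of x 2 "3 * m"] by simp
    also have "\<dots> = (-1) powi (3 * m) * (q powi m) powi (3 * m)"
      by (simp flip: power_int_mult_distrib)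
    also have "(-1 :: complex) powi (3 * m) = e"
      by (simp add: e_def power_int_mult)
    also have "(q powi m) powi (3 * m) = q powi (3 * (m * m))"
      by (simp add: mult_ac flip: power_int_mult)
    finally show ?thesis .
  qed
  have w: "(1 / x ^ 2) powi m = 1 / x powi (2 * m)"
    using power_int_mult[of x 2 m] by (simp add: power_int_divide_distrib)
  have "P ^ 3 / K * Theta (- x) q * Theta (1 / x ^ 3) (q ^ 3) / (q powi b * (1 / x ^ 2) powi m * P ^ 3)
     = - (N * T / (x * K)) * (e * (x powi m * x powi (3 * m) * x powi (2 * m)) *
           (q powi (- b) * q powi (- 3 * b - 3 * m) * q powi (- b)))"
    unfolding A B w using nz x q by (simp add: power_int_minus field_simps)
  also have "q powi (- b) * q powi (- 3 * b - 3 * m) * q powi (- b) = q powi (- 5 * b - 3 * m)"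
    using q by (simp flip: power_int_add)
  also have "e * (x powi m * x powi (3 * m) * x powi (2 * m)) * q powi (- 5 * b - 3 * m)
      = (e * e) * q powi (3 * (m * m) + (- 5 * b - 3 * m))"
    unfolding x6 using q by (simp add: power_int_add)
  also have "3 * (m * m) + (- 5 * b - 3 * m) = b"
    using binom2_double[of m] by (simp add: b_def algebra_simps)
  finally show ?thesis
    unfolding e(1) by (simp add: N_def T_def K_def P_def b_def)
qed

text \<open>Both singular pieces have a simple pole, carried by the common factor \<open>u x = 1 + q powi m / x ^ 2\<close>.
  The numerator \<open>n\<close> over this factor vanishes at \<open>x0\<close> by \<open>residue_cancellation\<close> and so absorbs the
  zero of \<open>u\<close>.\<close>

lemma remainder_form_removable:
  assumes q: "norm q < 1" "q \<noteq> 0" and x: "x0 \<noteq> 0" and zero: "Theta (- (1 / x0 ^ 2)) q = 0"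
  shows "\<exists>g. g analytic_on {x0} \<and>
    eventually (\<lambda>x. remainder_form q x = g x \<and> Theta (- (1 / x ^ 2)) q \<noteq> 0) (at x0)"
proof -
  have q3: "norm (q ^ 3) < 1" "q ^ 3 \<noteq> 0" using q by (auto intro: norm_power_lt_1)
  have x2: "1 / x0 ^ 2 \<noteq> 0" using x by simp
  obtain m where m: "1 + 1 / x0 ^ 2 * q powi m = 0"
    using zero Theta_eq_0_iff_lambert_pole[OF q x2] by blast
  hence qm: "q powi m = - (x0 ^ 2)" using x by (simp add: field_simps add_eq_0_iff)
  have Z: "{r. 1 + 1 / x0 ^ 2 * q powi r = 0} = {m}"
  proof -
    \<comment> \<open>only one term of the series is singular at \<open>x0\<close>, since the powers of \<open>q\<close> are distinct\<close>
    have "r = m" if "1 + 1 / x0 ^ 2 * q powi r = 0" for r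
    proof (rule ccontr)
      assume "r \<noteq> m"
      have "q powi r = q powi m" using that qm x by (simp add: field_simps add_eq_0_iff)
      hence "norm (q powi (r - m)) = 1" using q by (simp add: power_int_diff)
      thus False using norm_q_powi_ne_1[OF q, of "r - m"] \<open>r \<noteq> m\<close> by simp
    qed
    thus ?thesis using m by blast
  qed
  obtain g where g: "g analytic_on {1 / x0 ^ 2}" and
    ev: "eventually (\<lambda>z. lambert q z 1 = (\<Sum>r | 1 + 1 / x0 ^ 2 * q powi r = 0.
            q powi binom2 r * 1 powi r / (1 + z * q powi r)) + g z) (nhds (1 / x0 ^ 2))"
    using lambert_near[OF q x2, of 1] by auto
  define b where "b = binom2 m"
  define u where "u x = 1 + 1 / x ^ 2 * q powi m" for x
  \<comment> \<open>the cofactor of \<open>u\<close> in \<open>Theta (- (1 / x ^ 2)) q\<close>, nonzero at \<open>x0\<close>\<close>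
  define \<tau> where "\<tau> x = q powi b * (1 / x ^ 2) powi m * Theta_reduced (- (q powi m * (1 / x ^ 2))) q" for x
  define A where "A x = Theta (- (x ^ 3)) (q ^ 3) * Theta x q / (x * Theta (-1) q)" for x
  define B where "B x = qpoch_inf q q ^ 3 / Theta (-1) q * Theta (- x) q * Theta (1 / x ^ 3) (q ^ 3)" for x
  define R where "R x = Theta (- (x ^ 3)) (q ^ 3) * hecke123 q x
     - qpoch_inf q q / x * lambert (q ^ 3) (1 / q) (x ^ 3)
     - qpoch_inf q q / x ^ 2 * lambert (q ^ 3) (1 / q ^ 2) (x ^ 3) + A x * g (1 / x ^ 2)" for x
  define n where "n x = A x * q powi b + B x / \<tau> x" for x
  have inv: "(\<lambda>x. 1 / x ^ 2) analytic_on {x0}"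
    using x by (auto intro!: analytic_intros)
  have T1: "Theta (-1) q \<noteq> 0" by (rule Theta_minus_1_nonzero[OF q])
  have g': "(\<lambda>x. g (1 / x ^ 2)) analytic_on {x0}"
    using analytic_on_compose_gen[OF inv g] by (simp add: o_def)
  have F: "hecke123 q analytic_on {x0}"
    using hecke123_holomorphic[OF q] x by (simp add: analytic_on_holomorphic) blast
  have A: "A analytic_on {x0}"
    unfolding A_def[abs_def] using q q3 x T1 by (intro analytic_intros) auto
  have B: "B analytic_on {x0}"
    unfolding B_def[abs_def] using q q3 x T1 by (intro analytic_intros) auto
  have R: "R analytic_on {x0}"
    unfolding R_def[abs_def] using q q3 x by (intro analytic_intros A F g') auto
  have \<tau>: "\<tau> analytic_on {x0}"
    unfolding \<tau>_def[abs_def] using q x by (intro analytic_intros) auto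
  have \<tau>0: "\<tau> x0 = q powi b * (1 / x0 ^ 2) powi m * qpoch_inf q q ^ 3"
    using x by (simp add: \<tau>_def qm Theta_reduced_1)
  have \<tau>nz: "\<tau> x0 \<noteq> 0"
    unfolding \<tau>0 using q x qpoch_inf_self_nonzero[OF q(1)] by simp
  have n: "n analytic_on {x0}"
    unfolding n_def[abs_def] using \<tau>nz by (intro analytic_intros A B \<tau>) auto
  have n0: "n x0 = 0"
    using residue_cancellation[OF q x, of m] qm unfolding n_def A_def B_def \<tau>0 b_def by simp
  obtain h where h: "h analytic_on {x0}" "\<And>x. x \<noteq> x0 \<Longrightarrow> n x = (x - x0) * h x"
    using divide_out_zero[OF n n0] by blast
  define G where "G x = R x + x ^ 2 * h x / (x + x0)" for x
  have "G analytic_on {x0}"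
    unfolding G_def[abs_def] using x by (intro analytic_intros R h(1)) auto
  moreover have "eventually (\<lambda>x. remainder_form q x = G x \<and> Theta (- (1 / x ^ 2)) q \<noteq> 0) (at x0)"
  proof -
    have "eventually (\<lambda>x. lambert q (1 / x ^ 2) 1 = (\<Sum>r | 1 + 1 / x0 ^ 2 * q powi r = 0.
            q powi binom2 r * 1 powi r / (1 + 1 / x ^ 2 * q powi r)) + g (1 / x ^ 2)) (at x0)"
      using eventually_nhds_compose_analytic[OF inv ev] by (simp add: eventually_at_filter eventually_mono)
    moreover have "eventually (\<lambda>x. x \<noteq> 0) (at x0)" "eventually (\<lambda>x. x \<noteq> - x0) (at x0)" "eventually (\<lambda>x. x \<noteq> x0) (at x0)"
      using x by (auto intro!: eventually_neq_at_within)
    moreover have "eventually (\<lambda>x. \<tau> x \<noteq> 0) (at x0)"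
      using analytic_at_imp_isCont[OF \<tau>] \<tau>nz unfolding isCont_def by (rule tendsto_imp_eventually_ne)
    ultimately show ?thesis
    proof eventually_elim
      case (elim x)
      have u: "u x = (x - x0) * (x + x0) / x ^ 2"
        unfolding u_def qm using elim by (simp add: field_simps power2_eq_square)
      hence unz: "u x \<noteq> 0" using elim by (simp add: add_eq_0_iff2)
      have S: "Theta (- (1 / x ^ 2)) q = \<tau> x * u x"
      proof -
        have "Theta (q powi m * (- (1 / x ^ 2))) q = u x * Theta_reduced (- (q powi m * (1 / x ^ 2))) q"
          using Theta_conv_reduced[OF q(1), of "q powi m * (- (1 / x ^ 2))"] by (simp add: u_def mult.commute)
        moreover have "Theta (q powi m * (- (1 / x ^ 2))) q =
           (-1) powi m * q powi (- b) * (- (1 / x ^ 2)) powi (- m) * Theta (- (1 / x ^ 2)) q"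
          using Theta_mult_q_powi[OF q, of "- (1 / x ^ 2)" m] elim by (simp add: b_def)
        moreover have "(-1) powi m * (- (1 / x ^ 2)) powi (- m) = ((1 / x ^ 2) powi (- m) :: complex)"
        proof -
          have "(- (1 / x ^ 2)) powi (- m) = (-1) powi (- m) * (1 / x ^ 2) powi (- m)"
            by (simp flip: power_int_mult_distrib)
          moreover have "(-1) powi m * (-1) powi (- m) = (1 :: complex)"
            by (simp add: power_int_minus)
          ultimately show ?thesis by (simp flip: mult.assoc)
        qed
        ultimately have "u x * Theta_reduced (- (q powi m * (1 / x ^ 2))) q =
            q powi (- b) * (1 / x ^ 2) powi (- m) * Theta (- (1 / x ^ 2)) q"
          by (simp add: mult_ac)
        hence "q powi b * (1 / x ^ 2) powi m * (u x * Theta_reduced (- (q powi m * (1 / x ^ 2))) q) =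
            (q powi b * q powi (- b)) * ((1 / x ^ 2) powi m * (1 / x ^ 2) powi (- m)) * Theta (- (1 / x ^ 2)) q"
          by (simp only: mult_ac)
        also have "q powi b * q powi (- b) = 1" using q by (simp add: power_int_minus)
        also have "(1 / x ^ 2) powi m * (1 / x ^ 2) powi (- m) = 1"
          using elim by (simp add: power_int_minus)
        finally show ?thesis by (simp add: \<tau>_def mult_ac)
      qed
      have L: "lambert q (1 / x ^ 2) 1 = q powi b / u x + g (1 / x ^ 2)"
        using elim(1) unfolding Z by (simp add: u_def b_def)
      have "remainder_form q x = R x + (A x * q powi b / u x + B x / (\<tau> x * u x))"
        unfolding remainder_form_def R_def S L A_def[symmetric] B_def[symmetric]
        by (simp add: algebra_simps)
      also have "A x * q powi b / u x + B x / (\<tau> x * u x) = n x / u x"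
        unfolding n_def by (simp add: add_divide_distrib)
      also have "\<dots> = x ^ 2 * h x / (x + x0)"
        unfolding u using h(2)[of x] elim by simp
      finally show ?case
        using S unz elim by (simp add: G_def)
    qed
  qed
  ultimately show ?thesis by blast
qed

text \<open>The poles are removed by passing to \<open>remove_sings\<close>. The functional equation survives at the
  exceptional points by continuity, because they are isolated.\<close>

lemma remainder_form_eq_0:
  assumes q: "norm q < 1" "q \<noteq> 0" and x: "x \<noteq> 0" and nz: "Theta (- (1 / x ^ 2)) q \<noteq> 0"
  shows "remainder_form q x = 0"
proof -
  define h where "h = remove_sings (remainder_form q)"
  have regular: "h y = remainder_form q y" if "y \<noteq> 0" "Theta (- (1 / y ^ 2)) q \<noteq> 0" for y
    unfolding h_def using remainder_form_analytic[OF q that] by simp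
  have an: "h analytic_on {y}" if y: "y \<noteq> 0" for y
  proof (cases "Theta (- (1 / y ^ 2)) q = 0")
    case False
    show ?thesis
      unfolding h_def by (rule remove_sings_analytic_on[OF remainder_form_analytic[OF q y False]])
  next
    case True
    obtain g where g: "g analytic_on {y}" and "eventually (\<lambda>x. remainder_form q x = g x \<and> Theta (- (1 / x ^ 2)) q \<noteq> 0) (at y)"
      using remainder_form_removable[OF q y True] by blast
    hence ev: "eventually (\<lambda>x. remainder_form q x = g x) (at y)"
      by (auto elim: eventually_mono)
    have "isolated_singularity_at (remainder_form q) y"
      using isolated_singularity_at_analytic[OF g] isolated_singularity_at_cong[OF ev refl] by simp
    moreover have "remainder_form q \<midarrow>y\<rightarrow> g y"
      using analytic_at_imp_isCont[OF g] tendsto_cong[OF ev] by (simp add: isCont_def)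
    ultimately show ?thesis
      unfolding h_def by (rule remove_sings_analytic_at)
  qed
  have shift: "h (q * y) = - h y" if y: "y \<noteq> 0" for y
  proof -
    have good: "h (q * z) = - h z" if z: "z \<noteq> 0" "Theta (- (1 / z ^ 2)) q \<noteq> 0" for z
    proof -
      have "Theta (- (1 / (q * z) ^ 2)) q \<noteq> 0"
      proof
        assume "Theta (- (1 / (q * z) ^ 2)) q = 0"
        then obtain r where r: "1 + 1 / (q * z) ^ 2 * q powi r = 0"
          using Theta_eq_0_iff_lambert_pole[OF q, of "1 / (q * z) ^ 2"] q z by auto
        have "1 / (q * z) ^ 2 * q powi r = 1 / z ^ 2 * q powi (r - 2)"
          using q by (simp add: power_int_diff power_mult_distrib)
        hence "1 + 1 / z ^ 2 * q powi (r - 2) = 0" using r by simp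
        hence "Theta (- (1 / z ^ 2)) q = 0"
          using Theta_eq_0_iff_lambert_pole[OF q, of "1 / z ^ 2"] z by auto
        thus False using z by simp
      qed
      thus ?thesis
        using regular[OF z] regular[of "q * z"] remainder_form_shift[OF q z] q z by simp
    qed
    show ?thesis
    proof (cases "Theta (- (1 / y ^ 2)) q = 0")
      case True
      have "eventually (\<lambda>z. Theta (- (1 / z ^ 2)) q \<noteq> 0) (at y)"
        using remainder_form_removable[OF q y True] by (auto elim: eventually_mono)
      moreover have "eventually (\<lambda>z. z \<noteq> 0) (at y)"
        using y by (auto intro!: eventually_neq_at_within)
      ultimately have ev: "eventually (\<lambda>z. h (q * z) + h z = 0) (at y)"
        by eventually_elim (simp add: good)
      have "(\<lambda>z. q * z) analytic_on {y}" by (intro analytic_intros)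
      hence "(\<lambda>z. h (q * z)) analytic_on {y}"
        using analytic_on_compose_gen[of "\<lambda>z. q * z" "{y}" h "{q * y}"] an[of "q * y"] q y by (simp add: o_def)
      hence "(\<lambda>z. h (q * z) + h z) analytic_on {y}"
        using an[OF y] by (intro analytic_on_add)
      hence "(\<lambda>z. h (q * z) + h z) \<midarrow>y\<rightarrow> h (q * y) + h y"
        using analytic_at_imp_isCont isCont_def by blast
      moreover have "(\<lambda>z. h (q * z) + h z) \<midarrow>y\<rightarrow> 0"
        using tendsto_eventually[OF ev] .
      ultimately have "h (q * y) + h y = 0" by (rule LIM_unique)
      thus ?thesis by (simp add: eq_neg_iff_add_eq_0)
    qed (use good y in auto)
  qed
  have "h analytic_on -{0}"
    using an by (subst analytic_on_analytic_at) auto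
  hence "h holomorphic_on -{0}" by (rule analytic_imp_holomorphic)
  from antiperiodic_holomorphic_zero[OF q this shift x] have "h x = 0" .
  thus ?thesis using regular[OF x nz] by simp
qed

theorem corollary8p2:
  fixes q x :: complex
  assumes "0 < norm q" and "norm q < 1"
    and "x \<noteq> 0"
    and "Theta (- (x ^ 3)) (q ^ 3) \<noteq> 0"
    and "Theta (- (x powi (-2))) q \<noteq> 0"
  shows "hecke_f 1 2 3 (x powi (-1) * q ^ 2) (q ^ 3) q =
      x powi (-1) * appell_m (x powi (-3) * q ^ 2) (- (x ^ 3)) (q ^ 3) * qpoch_inf q q
    + x powi (-2) * appell_m (x powi (-3) * q) (- (x ^ 3)) (q ^ 3) * qpoch_inf q q
    - x powi (-1) * Theta x q * appell_m (q * x powi (-2)) (-1) q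
    - (qpoch_inf (q ^ 2) (q ^ 2) ^ 3 * Theta_idx 1 2 q * Theta (- x) q
         * Theta (x powi (-3)) (q ^ 3))
      / (Theta_bar_idx 0 2 q * Theta_bar_idx 1 2 q * Theta (- (x ^ 3)) (q ^ 3)
         * Theta (- (x powi (-2))) q)"
proof -
  have q: "norm q < 1" "q \<noteq> 0" using assms by auto
  have powi: "x powi (-1) = 1 / x" "x powi (-2) = 1 / x ^ 2" "x powi (-3) = 1 / x ^ 3"
    by (simp_all add: power_int_minus divide_inverse)
  have m1: "appell_m (1 / x ^ 3 * q ^ 2) (- (x ^ 3)) (q ^ 3) =
      lambert (q ^ 3) (1 / q) (x ^ 3) / Theta (- (x ^ 3)) (q ^ 3)"
    using q assms(3) by (subst appell_m_eq_lambert) (auto simp: eval_nat_numeral)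
  have m2: "appell_m (1 / x ^ 3 * q) (- (x ^ 3)) (q ^ 3) =
      lambert (q ^ 3) (1 / q ^ 2) (x ^ 3) / Theta (- (x ^ 3)) (q ^ 3)"
    using q assms(3) by (subst appell_m_eq_lambert) (auto simp: eval_nat_numeral)
  have m3: "appell_m (q * (1 / x ^ 2)) (-1) q = lambert q (1 / x ^ 2) 1 / Theta (-1) q"
    using q by (subst appell_m_eq_lambert) auto
  define N F P M1 M2 T L A Z S K where
    "N = Theta (- (x ^ 3)) (q ^ 3)" and "F = hecke123 q x" and "P = qpoch_inf q q"
    and "M1 = lambert (q ^ 3) (1 / q) (x ^ 3)" and "M2 = lambert (q ^ 3) (1 / q ^ 2) (x ^ 3)"
    and "T = Theta x q" and "L = lambert q (1 / x ^ 2) 1" and "A = Theta (- x) q"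
    and "Z = Theta (1 / x ^ 3) (q ^ 3)" and "S = Theta (- (1 / x ^ 2)) q" and "K = Theta (-1) q"
  have "remainder_form q x = 0"
    using remainder_form_eq_0[OF q assms(3)] assms(5) unfolding powi by blast
  hence "N * F = P / x * M1 + P / x ^ 2 * M2 - N * T / (x * K) * L - P ^ 3 / K * A * Z / S"
    unfolding remainder_form_def N_def F_def P_def M1_def M2_def T_def L_def A_def Z_def S_def K_def
    by (simp add: algebra_simps)
  hence "F = (P / x * M1 + P / x ^ 2 * M2 - N * T / (x * K) * L - P ^ 3 / K * A * Z / S) / N"
    using assms(4) by (simp add: N_def field_simps)
  also have "\<dots> = 1 / x * (M1 / N) * P + 1 / x ^ 2 * (M2 / N) * P - 1 / x * T * (L / K)
       - (P ^ 3 / K) * A * Z / (N * S)"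
    using assms(4) by (simp add: N_def[symmetric] add_divide_distrib diff_divide_distrib mult_ac)
  also have "P ^ 3 / K = qpoch_inf (q ^ 2) (q ^ 2) ^ 3 * Theta_idx 1 2 q / (Theta_bar_idx 0 2 q * Theta_bar_idx 1 2 q)"
    using theta_quotient_constant[OF q] by (simp add: P_def K_def)
  finally show ?thesis
    unfolding hecke_f_eq_hecke123[OF q(2) assms(3)] unfolding powi m1 m2 m3
    by (simp add: N_def F_def P_def M1_def M2_def T_def L_def A_def Z_def S_def K_def mult_ac)
qed

end
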